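(* Let $K$ be a commutative ring with $1$ and $n\ge 3$. Let $R=K[c_1,\dots,c_n]$ be the polynomial ring and let $J$ be the ideal of $R$ generated by the coefficients (entries) of the $2\times 2$-matrix $$\eta(c_n)\cdots\eta(c_2)\eta(c_1)+\mathrm{id},\qquad \eta(x)=\begin{pmatrix}x&-1\\1&0\end{pmatrix}.$$ There is a unique $K$-algebra isomorphism $$\bar\varphi: R/J\to\mathcal{G}(2,n),\qquad c_i\mapsto P_{i,i+2}\quad(1\le i\le n),$$ and the inverse of $\bar\varphi$ can be defined by $$\bar\varphi^{-1}(P_{i,j})=(\eta(c_{j-2})\cdots\eta(c_{i+1})\eta(c_i))_{11}\quad\text{for all }1\le i<j\le n,$$ where $(\cdot)_{11}$ denotes the entry in the first row and first column (and the empty product, for $j=i+1$, is the identity matrix).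
   Context: $\mathcal{O}(\mathrm{Gr}(2,n))$ denotes the homogeneous coordinate ring of the Grassmannian $\mathrm{Gr}(2,n)$, i.e. the commutative $K$-algebra generated by elements $P_{i,j}$ with $1\le i<j\le n$ subject to the Plücker relations $P_{i,k}P_{j,l}=P_{i,j}P_{k,l}+P_{i,l}P_{j,k}$ for all $1\le i<j<k<l\le n$. One sets $P_{i,j}=P_{j,i}$ for $1\le j<i\le n$, and the indices of the $P_{i,j}$ are read modulo $n$ (so e.g. $P_{n,n+1}=P_{1,n}$, $P_{n-1,n+1}=P_{1,n-1}$, $P_{n,n+2}=P_{2,n}$). Finally $\mathcal{G}(2,n)=\mathcal{O}(\mathrm{Gr}(2,n))/(P_{i,i+1}-1\mid i=1,\dots,n)$. *)

theory Defs
  imports "HOL-Algebra.Indexed_Polynomials" "HOL-Algebra.QuotRing"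
begin

section \<open>Polynomial rings in a set of indeterminates\<close>

text \<open>
  The library theory on indexed polynomials represents a polynomial with coefficients in \<open>K\<close> and
  indeterminates indexed by \<open>I\<close> as a function from monomials (multisets of indices) to coefficients.
  It provides the carrier, the constants, the indeterminates and the addition, but of the
  multiplication only the special case of multiplication by an indeterminate.
\<close>

definition poly_ring_mult ::
    "('k, 'b) ring_scheme \<Rightarrow> ('c multiset \<Rightarrow> 'k) \<Rightarrow> ('c multiset \<Rightarrow> 'k) \<Rightarrow> ('c multiset \<Rightarrow> 'k)"
  where "poly_ring_mult K p q = (\<lambda>m. \<Oplus>\<^bsub>K\<^esub>a\<in>{a. a \<subseteq># m}. p a \<otimes>\<^bsub>K\<^esub> q (m - a))"

definition poly_ring :: "('k, 'b) ring_scheme \<Rightarrow> 'c set \<Rightarrow> ('c multiset \<Rightarrow> 'k) ring"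
  where "poly_ring K I =
    \<lparr>carrier = ring.indexed_pset K I (carrier K),
     monoid.mult = poly_ring_mult K,
     one = ring.indexed_const K \<one>\<^bsub>K\<^esub>,
     zero = ring.indexed_const K \<zero>\<^bsub>K\<^esub>,
     add = ring.indexed_padd K\<rparr>"


section \<open>Homomorphisms of commutative algebras\<close>

text \<open>A commutative \<open>K\<close>-algebra is given by a commutative ring \<open>A\<close> together with its structure
  homomorphism \<open>\<alpha>\<close> from \<open>K\<close> to \<open>A\<close>.\<close>

definition alg_hom ::
    "('k, 'b) ring_scheme \<Rightarrow> ('a, 'c) ring_scheme \<Rightarrow> ('k \<Rightarrow> 'a) \<Rightarrow>
     ('d, 'e) ring_scheme \<Rightarrow> ('k \<Rightarrow> 'd) \<Rightarrow> ('a \<Rightarrow> 'd) set"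
  where "alg_hom K A \<alpha> B \<beta> = {h \<in> ring_hom A B. \<forall>k\<in>carrier K. h (\<alpha> k) = \<beta> k}"

definition alg_iso ::
    "('k, 'b) ring_scheme \<Rightarrow> ('a, 'c) ring_scheme \<Rightarrow> ('k \<Rightarrow> 'a) \<Rightarrow>
     ('d, 'e) ring_scheme \<Rightarrow> ('k \<Rightarrow> 'd) \<Rightarrow> ('a \<Rightarrow> 'd) set"
  where "alg_iso K A \<alpha> B \<beta> = alg_hom K A \<alpha> B \<beta> \<inter> ring_iso A B"


section \<open>Products of the matrices $\eta(x)$\<close>

datatype 'a mat2 = Mat2 (e11: 'a) (e12: 'a) (e21: 'a) (e22: 'a)

definition mat2_one :: "('a, 'b) ring_scheme \<Rightarrow> 'a mat2"
  where "mat2_one A = Mat2 \<one>\<^bsub>A\<^esub> \<zero>\<^bsub>A\<^esub> \<zero>\<^bsub>A\<^esub> \<one>\<^bsub>A\<^esub>"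

definition mat2_add :: "('a, 'b) ring_scheme \<Rightarrow> 'a mat2 \<Rightarrow> 'a mat2 \<Rightarrow> 'a mat2"
  where "mat2_add A M N =
    Mat2 (e11 M \<oplus>\<^bsub>A\<^esub> e11 N) (e12 M \<oplus>\<^bsub>A\<^esub> e12 N)
         (e21 M \<oplus>\<^bsub>A\<^esub> e21 N) (e22 M \<oplus>\<^bsub>A\<^esub> e22 N)"

definition mat2_mult :: "('a, 'b) ring_scheme \<Rightarrow> 'a mat2 \<Rightarrow> 'a mat2 \<Rightarrow> 'a mat2"
  where "mat2_mult A M N =
    Mat2 (e11 M \<otimes>\<^bsub>A\<^esub> e11 N \<oplus>\<^bsub>A\<^esub> e12 M \<otimes>\<^bsub>A\<^esub> e21 N)
         (e11 M \<otimes>\<^bsub>A\<^esub> e12 N \<oplus>\<^bsub>A\<^esub> e12 M \<otimes>\<^bsub>A\<^esub> e22 N)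
         (e21 M \<otimes>\<^bsub>A\<^esub> e11 N \<oplus>\<^bsub>A\<^esub> e22 M \<otimes>\<^bsub>A\<^esub> e21 N)
         (e21 M \<otimes>\<^bsub>A\<^esub> e12 N \<oplus>\<^bsub>A\<^esub> e22 M \<otimes>\<^bsub>A\<^esub> e22 N)"

definition eta :: "('a, 'b) ring_scheme \<Rightarrow> 'a \<Rightarrow> 'a mat2"
  where "eta A x = Mat2 x (\<ominus>\<^bsub>A\<^esub> \<one>\<^bsub>A\<^esub>) \<one>\<^bsub>A\<^esub> \<zero>\<^bsub>A\<^esub>"

text \<open>\<open>eta_prod A c i m\<close> is the product $\eta(c_{i+m-1}) \cdots \eta(c_{i+1})\,\eta(c_i)$ of \<open>m\<close>
  factors, with decreasing indices from left to right.\<close>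

primrec eta_prod :: "('a, 'b) ring_scheme \<Rightarrow> (nat \<Rightarrow> 'a) \<Rightarrow> nat \<Rightarrow> nat \<Rightarrow> 'a mat2"
  where
    "eta_prod A c i 0 = mat2_one A"
  | "eta_prod A c i (Suc m) = mat2_mult A (eta A (c (i + m))) (eta_prod A c i m)"


section \<open>The quotient $R/J$\<close>

definition ring_R :: "('k, 'b) ring_scheme \<Rightarrow> nat \<Rightarrow> (nat multiset \<Rightarrow> 'k) ring"
  where "ring_R K n = poly_ring K {1..n}"

definition ideal_J :: "('k, 'b) ring_scheme \<Rightarrow> nat \<Rightarrow> (nat multiset \<Rightarrow> 'k) set"
  where "ideal_J K n =
    (let M = mat2_add (ring_R K n)
               (eta_prod (ring_R K n) (ring.indexed_var K) 1 n) (mat2_one (ring_R K n))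
     in Idl\<^bsub>ring_R K n\<^esub> {e11 M, e12 M, e21 M, e22 M})"

definition R_mod_J :: "('k, 'b) ring_scheme \<Rightarrow> nat \<Rightarrow> (nat multiset \<Rightarrow> 'k) set ring"
  where "R_mod_J K n = ring_R K n Quot ideal_J K n"

definition class_J ::
    "('k, 'b) ring_scheme \<Rightarrow> nat \<Rightarrow> (nat multiset \<Rightarrow> 'k) \<Rightarrow> (nat multiset \<Rightarrow> 'k) set"
  where "class_J K n p = ideal_J K n +>\<^bsub>ring_R K n\<^esub> p"

definition const_J :: "('k, 'b) ring_scheme \<Rightarrow> nat \<Rightarrow> 'k \<Rightarrow> (nat multiset \<Rightarrow> 'k) set"
  where "const_J K n k = class_J K n (ring.indexed_const K k)"


section \<open>The ring $\mathcal{O}(\mathrm{Gr}(2,n))$ and its quotient $\mathcal{G}(2,n)$\<close>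

definition plu_index :: "nat \<Rightarrow> (nat \<times> nat) set"
  where "plu_index n = {(i, j). 1 \<le> i \<and> i < j \<and> j \<le> n}"

text \<open>\<open>red_index n i\<close> is the representative of \<open>i\<close> modulo \<open>n\<close> in the range from 1 to \<open>n\<close>; the summand
  \<open>n - 1\<close> avoids truncated subtraction.\<close>

definition red_index :: "nat \<Rightarrow> nat \<Rightarrow> nat"
  where "red_index n i = (i + (n - 1)) mod n + 1"

definition plu_ring :: "('k, 'b) ring_scheme \<Rightarrow> nat \<Rightarrow> ((nat \<times> nat) multiset \<Rightarrow> 'k) ring"
  where "plu_ring K n = poly_ring K (plu_index n)"

text \<open>The indeterminate $P_{i,j}$, where the indices are read modulo \<open>n\<close> and $P_{i,j} = P_{j,i}$. It is
  meaningful only if \<open>i\<close> and \<open>j\<close> are incongruent modulo \<open>n\<close>; otherwise the value lies outside the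
  polynomial ring (unless that ring is trivial).\<close>

definition plu_var ::
    "('k, 'b) ring_scheme \<Rightarrow> nat \<Rightarrow> nat \<Rightarrow> nat \<Rightarrow> ((nat \<times> nat) multiset \<Rightarrow> 'k)"
  where "plu_var K n i j =
    ring.indexed_var K
      (min (red_index n i) (red_index n j), max (red_index n i) (red_index n j))"

definition plu_ideal :: "('k, 'b) ring_scheme \<Rightarrow> nat \<Rightarrow> ((nat \<times> nat) multiset \<Rightarrow> 'k) set"
  where "plu_ideal K n =
    Idl\<^bsub>plu_ring K n\<^esub>
      {plu_var K n i k \<otimes>\<^bsub>plu_ring K n\<^esub> plu_var K n j l \<ominus>\<^bsub>plu_ring K n\<^esub>
         (plu_var K n i j \<otimes>\<^bsub>plu_ring K n\<^esub> plu_var K n k l \<oplus>\<^bsub>plu_ring K n\<^esub>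
          plu_var K n i l \<otimes>\<^bsub>plu_ring K n\<^esub> plu_var K n j k)
       | i j k l. 1 \<le> i \<and> i < j \<and> j < k \<and> k < l \<and> l \<le> n}"

definition O_Gr :: "('k, 'b) ring_scheme \<Rightarrow> nat \<Rightarrow> ((nat \<times> nat) multiset \<Rightarrow> 'k) set ring"
  where "O_Gr K n = plu_ring K n Quot plu_ideal K n"

definition P_Gr ::
    "('k, 'b) ring_scheme \<Rightarrow> nat \<Rightarrow> nat \<Rightarrow> nat \<Rightarrow> ((nat \<times> nat) multiset \<Rightarrow> 'k) set"
  where "P_Gr K n i j = plu_ideal K n +>\<^bsub>plu_ring K n\<^esub> plu_var K n i j"

definition const_Gr :: "('k, 'b) ring_scheme \<Rightarrow> nat \<Rightarrow> 'k \<Rightarrow> ((nat \<times> nat) multiset \<Rightarrow> 'k) set"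
  where "const_Gr K n k = plu_ideal K n +>\<^bsub>plu_ring K n\<^esub> ring.indexed_const K k"

definition frieze_ideal ::
    "('k, 'b) ring_scheme \<Rightarrow> nat \<Rightarrow> ((nat \<times> nat) multiset \<Rightarrow> 'k) set set"
  where "frieze_ideal K n =
    Idl\<^bsub>O_Gr K n\<^esub> {P_Gr K n i (i + 1) \<ominus>\<^bsub>O_Gr K n\<^esub> \<one>\<^bsub>O_Gr K n\<^esub> | i. 1 \<le> i \<and> i \<le> n}"

definition G_ring :: "('k, 'b) ring_scheme \<Rightarrow> nat \<Rightarrow> ((nat \<times> nat) multiset \<Rightarrow> 'k) set set ring"
  where "G_ring K n = O_Gr K n Quot frieze_ideal K n"

definition P_G ::
    "('k, 'b) ring_scheme \<Rightarrow> nat \<Rightarrow> nat \<Rightarrow> nat \<Rightarrow> ((nat \<times> nat) multiset \<Rightarrow> 'k) set set"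
  where "P_G K n i j = frieze_ideal K n +>\<^bsub>O_Gr K n\<^esub> P_Gr K n i j"

definition const_G :: "('k, 'b) ring_scheme \<Rightarrow> nat \<Rightarrow> 'k \<Rightarrow> ((nat \<times> nat) multiset \<Rightarrow> 'k) set set"
  where "const_G K n k = frieze_ideal K n +>\<^bsub>O_Gr K n\<^esub> const_Gr K n k"

end

theory Submission
  imports Defs
begin

text \<open>
  Put $P_{ii} = 0$. The Pluecker relations for $i < j - 1 < j < j + 1$ give
  $P_{i,j+1} = c_{j-1} P_{i,j} - P_{i,j-1}$, which is the recursion satisfied by the entries of
  $\eta(c_{j-2}) \cdots \eta(c_i)$; hence $P_{i,j}$ is a continuant in $c_i, \dots, c_{j-2}$.
  Closing up the recursion with $P_{1,n} = 1$, $c_{n-1} = P_{1,n-1}$, $c_n = P_{2,n}$ is equivalent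
  to $\eta(c_n) \cdots \eta(c_1) = -\mathrm{id}$. Conversely, continuants satisfy Euler's identity,
  which is the Pluecker relation. The resulting two homomorphisms are mutually inverse because
  they are so on generators.
\<close>

section \<open>Polynomial rings\<close>

text \<open>The continuants belonging to 1 \<le> i < j \<le> n involve only c_1, ..., c_{n-2},
  whereas R/J is presented by n generators. This shapes the closing step: c_{n-1} and c_n correspond
  to the wrapped elements P_{1,n-1} and P_{2,n}, and the matrix equation has to yield exactly these
  two expressions together with P_{1,n} = 1. In the opposite direction the lower right entry of the
  matrix equation does not follow from the recursion and the closing values alone. It comes from the
  Pluecker relation on 1, 2, n-1, n, which degenerates for n = 3. Since K may have zero divisors, no
  step cancels a factor. Each quotient is handled through its universal property: a homomorphism out
  of it is prescribed by values on generators that satisfy the relations, and is determined by these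
  values. The work on polynomial rings supplies what this needs, starting from a product that is a
  bare convolution.\<close>

lemma finite_subseteq_mset: "finite {a. a \<subseteq># (m :: 'a multiset)}"
proof (induction m)
  case (add x m)
  have "a \<in> {a. a \<subseteq># m} \<union> add_mset x ` {a. a \<subseteq># m}" if "a \<subseteq># add_mset x m" for a
  proof (cases "x \<in># a")
    case True
    then obtain b where "a = add_mset x b" by (metis insert_DiffM)
    then show ?thesis using that by auto
  next
    case False
    then have "a \<subseteq># m" using that
      by (metis add_mset_remove_trivial diff_single_trivial subset_eq_diff_conv add_mset_add_single)
    then show ?thesis by simp
  qed
  then have "{a. a \<subseteq># add_mset x m} \<subseteq> {a. a \<subseteq># m} \<union> add_mset x ` {a. a \<subseteq># m}" by blast
  then show ?case using add.IH finite_subset by blast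
qed simp

context cring
begin

lemma indexed_pset_closed: "p \<in> indexed_pset I (carrier R) \<Longrightarrow> p m \<in> carrier R"
  using indexed_pset_in_carrier carrier_coeffE by blast

lemma poly_ring_mult_closed:
  assumes "\<And>m. p m \<in> carrier R" "\<And>m. q m \<in> carrier R"
  shows "poly_ring_mult R p q m \<in> carrier R"
  unfolding poly_ring_mult_def using assms by (intro finsum_closed) auto

text \<open>This and the next two lemmas compute the convolution when the left factor is built by
  one of the three constructors of \<open>indexed_pset\<close>. The ring axioms then follow by
  induction on the left factor instead of by manipulating double sums.\<close>

lemma poly_ring_mult_const:
  assumes "k \<in> carrier R" "\<And>m. q m \<in> carrier R"
  shows "poly_ring_mult R (indexed_const k) q = (\<lambda>m. k \<otimes> q m)"
proof
  fix m
  have "poly_ring_mult R (indexed_const k) q m =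
        (\<Oplus>a\<in>{{#}}. indexed_const k a \<otimes> q (m - a))"
    unfolding poly_ring_mult_def
    by (rule add.finprod_mono_neutral_cong_right)
       (use assms in \<open>auto simp: finite_subseteq_mset indexed_const_def\<close>)
  also have "\<dots> = k \<otimes> q m" using assms by (simp add: indexed_const_def)
  finally show "poly_ring_mult R (indexed_const k) q m = k \<otimes> q m" .
qed

lemma poly_ring_mult_padd:
  assumes "\<And>m. p m \<in> carrier R" "\<And>m. p' m \<in> carrier R" "\<And>m. q m \<in> carrier R"
  shows "poly_ring_mult R (indexed_padd p p') q =
         indexed_padd (poly_ring_mult R p q) (poly_ring_mult R p' q)"
proof
  fix m
  show "poly_ring_mult R (indexed_padd p p') q m =
        indexed_padd (poly_ring_mult R p q) (poly_ring_mult R p' q) m"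
    unfolding poly_ring_mult_def indexed_padd_def
    by (subst finsum_addf[symmetric]) (use assms in \<open>auto simp: l_distr intro!: finsum_cong'\<close>)
qed

text \<open>Only submultisets containing \<open>i\<close> contribute on the left, and removing one
  copy of \<open>i\<close> matches them with the submultisets of \<open>m - {#i#}\<close>.\<close>

lemma poly_ring_mult_pmult:
  assumes "\<And>m. p m \<in> carrier R" "\<And>m. q m \<in> carrier R"
  shows "poly_ring_mult R (indexed_pmult p i) q = indexed_pmult (poly_ring_mult R p q) i"
proof
  fix m
  have "poly_ring_mult R (indexed_pmult p i) q m =
        (\<Oplus>a\<in>{a. a \<subseteq># m \<and> i \<in># a}. p (a - {#i#}) \<otimes> q (m - a))"
    unfolding poly_ring_mult_def indexed_pmult_def
    by (rule add.finprod_mono_neutral_cong_right)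
       (use assms in \<open>auto simp: finite_subseteq_mset\<close>)
  also have "\<dots> = indexed_pmult (poly_ring_mult R p q) i m"
  proof (cases "i \<in># m")
    case True
    then obtain m' where m: "m = add_mset i m'" by (metis insert_DiffM)
    have "{a. a \<subseteq># m \<and> i \<in># a} = add_mset i ` {a. a \<subseteq># m'}"
    proof (intro equalityI subsetI)
      fix a assume a: "a \<in> {a. a \<subseteq># m \<and> i \<in># a}"
      then obtain b where "a = add_mset i b" by (metis (mono_tags) insert_DiffM mem_Collect_eq)
      with a m show "a \<in> add_mset i ` {a. a \<subseteq># m'}" by auto
    qed (auto simp: m)
    then have "(\<Oplus>a\<in>{a. a \<subseteq># m \<and> i \<in># a}. p (a - {#i#}) \<otimes> q (m - a)) =
        (\<Oplus>a\<in>{a. a \<subseteq># m'}. p (add_mset i a - {#i#}) \<otimes> q (m - add_mset i a))"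
      using assms by (simp only:) (rule finsum_reindex, auto simp: inj_on_def)
    then show ?thesis
      by (simp add: m indexed_pmult_def poly_ring_mult_def)
  next
    case False
    then have "{a. a \<subseteq># m \<and> i \<in># a} = {}" by (auto dest: mset_subset_eqD)
    then show ?thesis using False by (simp only: indexed_pmult_def if_False finsum_empty)
  qed
  finally show "poly_ring_mult R (indexed_pmult p i) q m = indexed_pmult (poly_ring_mult R p q) i m" .
qed

text \<open>Reindexing by the complement \<open>a \<mapsto> m - a\<close>, an involution on the
  submultisets of \<open>m\<close>.\<close>

lemma poly_ring_mult_commute:
  fixes p q :: "'d multiset \<Rightarrow> 'a"
  assumes "\<And>m. p m \<in> carrier R" "\<And>m. q m \<in> carrier R"
  shows "poly_ring_mult R p q = poly_ring_mult R q p"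
proof
  fix m :: "'d multiset"
  have inv: "m - (m - a) = a" if "a \<subseteq># m" for a
    using that by (metis add_diff_cancel_right' subset_mset.add_diff_inverse)
  have "{a. a \<subseteq># m} = (\<lambda>a. m - a) ` {a. a \<subseteq># m}"
  proof (intro equalityI subsetI)
    fix a assume "a \<in> {a. a \<subseteq># m}"
    then show "a \<in> (\<lambda>a. m - a) ` {a. a \<subseteq># m}"
      using inv[of a] by (intro image_eqI[of _ _ "m - a"]) auto
  qed auto
  then have "poly_ring_mult R p q m =
      (\<Oplus>a\<in>(\<lambda>a. m - a) ` {a. a \<subseteq># m}. p a \<otimes> q (m - a))"
    by (simp add: poly_ring_mult_def)
  also have "\<dots> = (\<Oplus>a\<in>{a. a \<subseteq># m}. p (m - a) \<otimes> q (m - (m - a)))"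
    by (rule finsum_reindex) (use assms inv in \<open>auto simp: inj_on_def, metis\<close>)
  also have "\<dots> = poly_ring_mult R q p m"
    unfolding poly_ring_mult_def
    by (rule finsum_cong') (use assms inv m_comm in auto)
  finally show "poly_ring_mult R p q m = poly_ring_mult R q p m" .
qed

lemma poly_ring_mult_mem:
  fixes p q :: "'d multiset \<Rightarrow> 'a"
  assumes p: "p \<in> indexed_pset I (carrier R)" and q: "q \<in> indexed_pset I (carrier R)"
  shows "poly_ring_mult R p q \<in> indexed_pset I (carrier R)"
proof -
  \<comment> \<open>Base case of the induction on \<open>p\<close>: a scalar multiple of
    \<open>q\<close> is again a polynomial, which takes an induction on \<open>q\<close>.\<close>
  have const: "(\<lambda>m. k \<otimes> q m) \<in> indexed_pset I (carrier R)" if k: "k \<in> carrier R" for k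
    using q
  proof induction
    case (indexed_const l)
    then have "(\<lambda>m :: 'd multiset. k \<otimes> ring.indexed_const R l m) = ring.indexed_const R (k \<otimes> l)"
      using k by (auto simp: indexed_const_def)
    with indexed_const k show ?case by (simp add: indexed_pset.indexed_const)
  next
    case (indexed_padd p q)
    have "(\<lambda>m. k \<otimes> ring.indexed_padd R p q m) =
          ring.indexed_padd R (\<lambda>m. k \<otimes> p m) (\<lambda>m. k \<otimes> q m)"
      using k indexed_padd(1,2)[THEN indexed_pset_closed] by (auto simp: indexed_padd_def r_distr)
    with indexed_padd show ?case by (simp add: indexed_pset.indexed_padd)
  next
    case (indexed_pmult p i)
    have "(\<lambda>m. k \<otimes> ring.indexed_pmult R p i m) = ring.indexed_pmult R (\<lambda>m. k \<otimes> p m) i"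
      using k by (auto simp: indexed_pmult_def)
    with indexed_pmult show ?case by (simp add: indexed_pset.indexed_pmult)
  qed
  note q' = indexed_pset_closed[OF q]
  show ?thesis using p
  proof induction
    case (indexed_const k)
    then show ?case using const q' by (simp add: poly_ring_mult_const)
  next
    case (indexed_padd p p')
    then show ?case using q' by (simp add: poly_ring_mult_padd indexed_pset_closed indexed_pset.indexed_padd)
  next
    case (indexed_pmult p i)
    then show ?case using q' by (simp add: poly_ring_mult_pmult indexed_pset_closed indexed_pset.indexed_pmult)
  qed
qed

text \<open>The induction only takes apart the left factor, so \<open>q\<close> and \<open>r\<close>
  may be arbitrary coefficient functions with values in the carrier.\<close>

lemma poly_ring_mult_assoc:
  assumes p: "p \<in> indexed_pset I (carrier R)"
    and q: "\<And>m. q m \<in> carrier R" and r: "\<And>m. r m \<in> carrier R"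
  shows "poly_ring_mult R (poly_ring_mult R p q) r = poly_ring_mult R p (poly_ring_mult R q r)"
  using p
proof induction
  case (indexed_const k)
  have "poly_ring_mult R (\<lambda>m. k \<otimes> q m) r m = k \<otimes> poly_ring_mult R q r m" for m
    unfolding poly_ring_mult_def
    by (subst finsum_rdistr)
       (use indexed_const q r in \<open>auto simp: finite_subseteq_mset m_assoc intro!: finsum_cong'\<close>)
  with indexed_const q r show ?case by (auto simp: poly_ring_mult_const poly_ring_mult_closed)
next
  case (indexed_padd p p')
  then show ?case using q r
    by (simp add: poly_ring_mult_padd poly_ring_mult_closed indexed_pset_closed)
next
  case (indexed_pmult p i)
  then show ?case using q r
    by (simp add: poly_ring_mult_pmult poly_ring_mult_closed indexed_pset_closed)
qed

lemma indexed_const_mem: "k \<in> carrier R \<Longrightarrow> indexed_const k \<in> carrier (poly_ring R I)"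
  by (simp add: poly_ring_def indexed_pset.indexed_const)

lemma indexed_var_mem: "i \<in> I \<Longrightarrow> indexed_var i \<in> carrier (poly_ring R I)"
  by (simp add: poly_ring_def indexed_var_def indexed_pset.indexed_const indexed_pset.indexed_pmult)

lemma poly_ring_cring: "cring (poly_ring R I)"
proof (rule cringI)
  note cl = indexed_pset_closed
  show "abelian_group (poly_ring R I)"
  proof (rule abelian_groupI)
    fix p assume p: "p \<in> carrier (poly_ring R I)"
    then have p': "p m \<in> carrier R" for m by (simp add: poly_ring_def cl)
    \<comment> \<open>The additive inverse is taken as the product with the constant -1, because
      closure under products is already available.\<close>
    have "poly_ring_mult R (indexed_const (\<ominus> \<one>)) p \<in> carrier (poly_ring R I)"
      using p by (simp add: poly_ring_def poly_ring_mult_mem indexed_pset.indexed_const)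
    moreover have "indexed_padd (poly_ring_mult R (indexed_const (\<ominus> \<one>)) p) p = indexed_const \<zero>"
      unfolding indexed_zero_def indexed_padd_def
      using p' by (simp add: poly_ring_mult_const l_minus l_neg)
    ultimately show "\<exists>q\<in>carrier (poly_ring R I). q \<oplus>\<^bsub>poly_ring R I\<^esub> p = \<zero>\<^bsub>poly_ring R I\<^esub>"
      by (auto simp: poly_ring_def)
  next
    fix p q r assume "p \<in> carrier (poly_ring R I)" "q \<in> carrier (poly_ring R I)"
      "r \<in> carrier (poly_ring R I)"
    then show "p \<oplus>\<^bsub>poly_ring R I\<^esub> q \<oplus>\<^bsub>poly_ring R I\<^esub> r =
        p \<oplus>\<^bsub>poly_ring R I\<^esub> (q \<oplus>\<^bsub>poly_ring R I\<^esub> r)"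
      by (auto simp: poly_ring_def indexed_padd_def a_assoc cl)
  next
    fix p q assume "p \<in> carrier (poly_ring R I)" "q \<in> carrier (poly_ring R I)"
    then show "p \<oplus>\<^bsub>poly_ring R I\<^esub> q = q \<oplus>\<^bsub>poly_ring R I\<^esub> p"
      by (auto simp: poly_ring_def indexed_padd_def a_comm cl)
  next
    fix p assume "p \<in> carrier (poly_ring R I)"
    then show "\<zero>\<^bsub>poly_ring R I\<^esub> \<oplus>\<^bsub>poly_ring R I\<^esub> p = p"
      by (auto simp: poly_ring_def indexed_padd_def indexed_zero_def cl)
  qed (auto simp: poly_ring_def indexed_pset.indexed_padd indexed_pset.indexed_const)
  show "comm_monoid (poly_ring R I)"
  proof (rule comm_monoidI)
    fix p q assume "p \<in> carrier (poly_ring R I)" "q \<in> carrier (poly_ring R I)"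
    then show "p \<otimes>\<^bsub>poly_ring R I\<^esub> q = q \<otimes>\<^bsub>poly_ring R I\<^esub> p"
      by (simp add: poly_ring_def cl poly_ring_mult_commute)
  qed (auto simp: poly_ring_def poly_ring_mult_mem indexed_pset.indexed_const
         poly_ring_mult_const cl poly_ring_mult_assoc)
qed (auto simp: poly_ring_def poly_ring_mult_padd indexed_pset_closed)

text \<open>Links the shift \<open>indexed_pmult\<close> to the ring product, so that the generation
  of polynomials can be expressed by ring operations alone.\<close>

lemma poly_ring_mult_var:
  fixes p :: "'d multiset \<Rightarrow> 'a"
  assumes "p \<in> carrier (poly_ring R I)"
  shows "p \<otimes>\<^bsub>poly_ring R I\<^esub> indexed_var i = indexed_pmult p i"
proof -
  have p: "p m \<in> carrier R" for m using assms by (simp add: poly_ring_def indexed_pset_closed)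
  have c: "indexed_const \<one> m \<in> carrier R" for m :: "'d multiset" by (simp add: indexed_const_def)
  have "indexed_var i m \<in> carrier R" for m
    by (simp add: indexed_var_def indexed_pmult_def c)
  then have "poly_ring_mult R p (indexed_var i) = poly_ring_mult R (indexed_var i) p"
    using p poly_ring_mult_commute by blast
  also have "\<dots> = indexed_pmult p i"
    using p c by (simp add: indexed_var_def poly_ring_mult_pmult poly_ring_mult_const)
  finally show ?thesis by (simp add: poly_ring_def)
qed

lemma indexed_const_hom:
  "(indexed_const :: 'a \<Rightarrow> 'd multiset \<Rightarrow> 'a) \<in> ring_hom R (poly_ring R I)"
proof (rule ring_hom_memI)
  fix k l assume kl: "k \<in> carrier R" "l \<in> carrier R"
  then have "poly_ring_mult R (indexed_const k) (indexed_const l) = (\<lambda>m :: 'd multiset. k \<otimes> indexed_const l m)"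
    by (intro poly_ring_mult_const) (auto simp: indexed_const_def)
  also have "\<dots> = indexed_const (k \<otimes> l)" using kl by (auto simp: indexed_const_def)
  finally show "indexed_const (k \<otimes> l) = indexed_const k \<otimes>\<^bsub>poly_ring R I\<^esub> indexed_const l"
    by (simp add: poly_ring_def)
qed (auto simp: indexed_const_mem, auto simp: poly_ring_def indexed_padd_def indexed_const_def)

lemma poly_ring_induct [consumes 1, case_names const add var]:
  assumes "p \<in> carrier (poly_ring R I)"
    and "\<And>k. k \<in> carrier R \<Longrightarrow> P (indexed_const k)"
    and "\<And>p q. p \<in> carrier (poly_ring R I) \<Longrightarrow> q \<in> carrier (poly_ring R I) \<Longrightarrow> P p \<Longrightarrow> P q \<Longrightarrow>
           P (p \<oplus>\<^bsub>poly_ring R I\<^esub> q)"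
    and "\<And>p i. p \<in> carrier (poly_ring R I) \<Longrightarrow> i \<in> I \<Longrightarrow> P p \<Longrightarrow>
           P (p \<otimes>\<^bsub>poly_ring R I\<^esub> indexed_var i)"
  shows "P p"
proof -
  have "p \<in> indexed_pset I (carrier R)" using assms(1) by (simp add: poly_ring_def)
  then show ?thesis
  proof induction
    case (indexed_const k) then show ?case by (rule assms(2))
  next
    case (indexed_padd p q) then show ?case using assms(3)[of p q] by (simp add: poly_ring_def)
  next
    case (indexed_pmult p i)
    then have "p \<in> carrier (poly_ring R I)" by (simp add: poly_ring_def)
    then show ?case using assms(4)[of p i] poly_ring_mult_var[of p I i] indexed_pmult by simp
  qed
qed

text \<open>Uniqueness half of the universal property of the polynomial ring; the existence half is
  \<open>poly_ring_eval\<close>.\<close>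

lemma poly_ring_hom_eqI:
  assumes A: "ring A" and f: "f \<in> ring_hom (poly_ring R I) A" and g: "g \<in> ring_hom (poly_ring R I) A"
    and "\<And>k. k \<in> carrier R \<Longrightarrow> f (indexed_const k) = g (indexed_const k)"
    and "\<And>i. i \<in> I \<Longrightarrow> f (indexed_var i) = g (indexed_var i)"
    and "p \<in> carrier (poly_ring R I)"
  shows "f p = g p"
  using assms(6)
  by (induction rule: poly_ring_induct)
     (use assms in \<open>auto simp: ring_hom_add[OF f] ring_hom_add[OF g] ring_hom_mult[OF f]
        ring_hom_mult[OF g] indexed_var_mem\<close>)

end

section \<open>Evaluation of polynomials at a point of a commutative algebra\<close>

definition mset_eval :: "('a, 'b) monoid_scheme \<Rightarrow> ('c \<Rightarrow> 'a) \<Rightarrow> 'c multiset \<Rightarrow> 'a"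
  where "mset_eval G c m = (\<Otimes>\<^bsub>G\<^esub>i\<in>set_mset m. c i [^]\<^bsub>G\<^esub> count m i)"

context comm_monoid
begin

lemma mset_eval_closed: "(\<And>i. c i \<in> carrier G) \<Longrightarrow> mset_eval G c m \<in> carrier G"
  unfolding mset_eval_def by (rule finprod_closed) auto

lemma mset_eval_empty: "mset_eval G c {#} = \<one>"
  by (simp add: mset_eval_def)

lemma mset_eval_add_mset:
  assumes c: "\<And>i. c i \<in> carrier G"
  shows "mset_eval G c (add_mset i m) = mset_eval G c m \<otimes> c i"
proof -
  \<comment> \<open>Both monomials are written as products over this common index set; if
    \<open>i\<close> does not occur in \<open>m\<close>, its exponent there is 0 and it contributes
    the factor 1.\<close>
  let ?S = "insert i (set_mset m)"
  have "mset_eval G c (add_mset i m) =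
      (\<Otimes>j\<in>?S. c j [^] count m j \<otimes> (if i = j then c j else \<one>))"
    unfolding mset_eval_def using c by (intro finprod_cong') auto
  also have "\<dots> = (\<Otimes>j\<in>?S. c j [^] count m j) \<otimes> (\<Otimes>j\<in>?S. if i = j then c j else \<one>)"
    by (rule finprod_multf) (use c in auto)
  also have "(\<Otimes>j\<in>?S. if i = j then c j else \<one>) = c i"
    by (rule finprod_singleton) (use c in auto)
  also have "(\<Otimes>j\<in>?S. c j [^] count m j) = mset_eval G c m"
    unfolding mset_eval_def
    by (rule finprod_mono_neutral_cong_right) (use c in \<open>auto simp: not_in_iff\<close>)
  finally show ?thesis .
qed

end

definition poly_ring_eval ::
    "('k, 'b) ring_scheme \<Rightarrow> ('a, 'd) ring_scheme \<Rightarrow> ('k \<Rightarrow> 'a) \<Rightarrow> ('c \<Rightarrow> 'a) \<Rightarrow>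
     ('c multiset \<Rightarrow> 'k) \<Rightarrow> 'a"
  where "poly_ring_eval K A \<alpha> c p =
    (\<Oplus>\<^bsub>A\<^esub>m\<in>{m. p m \<noteq> \<zero>\<^bsub>K\<^esub>}. \<alpha> (p m) \<otimes>\<^bsub>A\<^esub> mset_eval A c m)"

lemma (in cring) finite_support_poly_ring:
  assumes "p \<in> carrier (poly_ring R I)"
  shows "finite {m. p m \<noteq> \<zero>}"
proof -
  have "p \<in> indexed_pset I (carrier R)" using assms by (simp add: poly_ring_def)
  then show ?thesis
  proof induction
    case (indexed_const k)
    then show ?case by (auto simp: indexed_const_def intro: finite_subset[of _ "{{#}}"])
  next
    case (indexed_padd p q)
    have "{m. ring.indexed_padd R p q m \<noteq> \<zero>} \<subseteq> {m. p m \<noteq> \<zero>} \<union> {m. q m \<noteq> \<zero>}"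
      by (auto simp: indexed_padd_def)
    then show ?case using indexed_padd.IH by (meson finite_UnI finite_subset)
  next
    case (indexed_pmult p i)
    have "{m. ring.indexed_pmult R p i m \<noteq> \<zero>} \<subseteq> add_mset i ` {m. p m \<noteq> \<zero>}"
    proof
      fix m assume "m \<in> {m. ring.indexed_pmult R p i m \<noteq> \<zero>}"
      then have "i \<in># m" "p (m - {#i#}) \<noteq> \<zero>" by (auto simp: indexed_pmult_def split: if_splits)
      then show "m \<in> add_mset i ` {m. p m \<noteq> \<zero>}"
        by (intro image_eqI[of _ _ "m - {#i#}"]) auto
    qed
    then show ?case using indexed_pmult.IH by (meson finite_imageI finite_subset)
  qed
qed

text \<open>Multiplicativity is not read off the convolution. It is known for a factor that is an
  indeterminate (\<open>h_var\<close>) or a constant (\<open>const_mult\<close>), and induction on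
  the left factor extends it to all polynomials.\<close>

lemma poly_ring_eval:
  fixes K :: "('k, 'b) ring_scheme" and c :: "'c \<Rightarrow> 'a"
  assumes K: "cring K" and A: "cring A" and \<alpha>: "\<alpha> \<in> ring_hom K A" and c: "\<And>i. c i \<in> carrier A"
  shows poly_ring_eval_hom: "poly_ring_eval K A \<alpha> c \<in> ring_hom (poly_ring K I) A"
    and poly_ring_eval_const: "\<And>k. k \<in> carrier K \<Longrightarrow>
          poly_ring_eval K A \<alpha> c (ring.indexed_const K k) = \<alpha> k"
    and poly_ring_eval_var: "\<And>i. poly_ring_eval K A \<alpha> c (ring.indexed_var K i) = c i"
proof -
  interpret K: cring K by fact
  interpret A: cring A by fact
  interpret h: ring_hom_cring K A \<alpha> using K A \<alpha> by (simp add: ring_hom_cring_def ring_hom_cring_axioms_def)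
  let ?h = "poly_ring_eval K A \<alpha> c" and ?P = "poly_ring K I"
  interpret P: cring ?P by (rule K.poly_ring_cring)
  note mc [simp] = A.mset_eval_closed[OF c]
  have cf: "p m \<in> carrier K" if "p \<in> carrier ?P" for p m
    using that by (simp add: poly_ring_def K.indexed_pset_closed)
  \<comment> \<open>The sum may run over any finite set containing the support. This gives two
    polynomials and their sum a common index set.\<close>
  have eq: "?h p = (\<Oplus>\<^bsub>A\<^esub>m\<in>S. \<alpha> (p m) \<otimes>\<^bsub>A\<^esub> mset_eval A c m)"
    if "p \<in> carrier ?P" "finite S" "{m. p m \<noteq> \<zero>\<^bsub>K\<^esub>} \<subseteq> S" for p S
    unfolding poly_ring_eval_def
    by (rule A.add.finprod_mono_neutral_cong_left) (use that cf in auto)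
  have closed: "?h p \<in> carrier A" if "p \<in> carrier ?P" for p
    unfolding poly_ring_eval_def using that cf by (intro A.finsum_closed) auto
  have h_const: "?h (K.indexed_const k) = \<alpha> k" if "k \<in> carrier K" for k
  proof -
    have "?h (K.indexed_const k) =
        (\<Oplus>\<^bsub>A\<^esub>m\<in>{{#}}. \<alpha> (K.indexed_const k m) \<otimes>\<^bsub>A\<^esub> mset_eval A c m)"
      using that by (intro eq K.indexed_const_mem) (auto simp: K.indexed_const_def)
    also have "\<dots> = \<alpha> k" using that by (simp add: K.indexed_const_def A.mset_eval_empty)
    finally show ?thesis .
  qed
  have h_add: "?h (p \<oplus>\<^bsub>?P\<^esub> q) = ?h p \<oplus>\<^bsub>A\<^esub> ?h q"
    if p: "p \<in> carrier ?P" and q: "q \<in> carrier ?P" for p q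
  proof -
    let ?S = "{m. p m \<noteq> \<zero>\<^bsub>K\<^esub>} \<union> {m. q m \<noteq> \<zero>\<^bsub>K\<^esub>}"
    have fin: "finite ?S" using p q K.finite_support_poly_ring by auto
    have pq: "p \<oplus>\<^bsub>?P\<^esub> q = (\<lambda>m. p m \<oplus>\<^bsub>K\<^esub> q m)"
      by (simp add: poly_ring_def K.indexed_padd_def)
    have mem: "(\<lambda>m. p m \<oplus>\<^bsub>K\<^esub> q m) \<in> carrier ?P"
      using P.a_closed[OF p q] by (simp only: pq)
    have "?h (p \<oplus>\<^bsub>?P\<^esub> q) =
        (\<Oplus>\<^bsub>A\<^esub>m\<in>?S. \<alpha> (p m) \<otimes>\<^bsub>A\<^esub> mset_eval A c m \<oplus>\<^bsub>A\<^esub> \<alpha> (q m) \<otimes>\<^bsub>A\<^esub> mset_eval A c m)"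
      unfolding pq using p q fin cf mem by (subst eq[of _ ?S]) (auto simp: A.l_distr intro!: A.finsum_cong')
    also have "\<dots> = ?h p \<oplus>\<^bsub>A\<^esub> ?h q"
      using p q fin cf by (subst A.finsum_addf) (auto simp: eq[of _ ?S])
    finally show ?thesis .
  qed
  \<comment> \<open>The support of the shifted polynomial lies in the image of the support of
    \<open>p\<close> under \<open>add_mset i\<close>; reindexing along this injection splits off one
    factor \<open>c i\<close> from every monomial.\<close>
  have h_var: "?h (p \<otimes>\<^bsub>?P\<^esub> K.indexed_var i) = ?h p \<otimes>\<^bsub>A\<^esub> c i" if p: "p \<in> carrier ?P" for p i
  proof -
    let ?S = "{m. p m \<noteq> \<zero>\<^bsub>K\<^esub>}"
    have fin: "finite ?S" using p K.finite_support_poly_ring by auto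
    have "?h (K.indexed_pmult p i) =
        (\<Oplus>\<^bsub>A\<^esub>m\<in>add_mset i ` ?S. \<alpha> (K.indexed_pmult p i m) \<otimes>\<^bsub>A\<^esub> mset_eval A c m)"
      unfolding poly_ring_eval_def
    proof (rule A.add.finprod_mono_neutral_cong_left)
      show "{m. K.indexed_pmult p i m \<noteq> \<zero>\<^bsub>K\<^esub>} \<subseteq> add_mset i ` ?S"
      proof
        fix m assume "m \<in> {m. K.indexed_pmult p i m \<noteq> \<zero>\<^bsub>K\<^esub>}"
        then have "i \<in># m" "p (m - {#i#}) \<noteq> \<zero>\<^bsub>K\<^esub>"
          by (auto simp: K.indexed_pmult_def split: if_splits)
        then show "m \<in> add_mset i ` ?S" by (intro image_eqI[of _ _ "m - {#i#}"]) auto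
      qed
    qed (use fin cf p in \<open>auto simp: K.indexed_pmult_def\<close>)
    also have "\<dots> = (\<Oplus>\<^bsub>A\<^esub>m\<in>?S. \<alpha> (K.indexed_pmult p i (add_mset i m)) \<otimes>\<^bsub>A\<^esub> mset_eval A c (add_mset i m))"
      by (rule A.finsum_reindex) (use cf p in \<open>auto simp: K.indexed_pmult_def inj_on_def\<close>)
    also have "\<dots> = (\<Oplus>\<^bsub>A\<^esub>m\<in>?S. \<alpha> (p m) \<otimes>\<^bsub>A\<^esub> mset_eval A c m \<otimes>\<^bsub>A\<^esub> c i)"
      by (rule A.finsum_cong')
         (use cf p c in \<open>auto simp: K.indexed_pmult_def A.mset_eval_add_mset[OF c] A.m_assoc\<close>)
    also have "\<dots> = ?h p \<otimes>\<^bsub>A\<^esub> c i"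
      unfolding poly_ring_eval_def using fin c cf p by (subst A.finsum_ldistr) auto
    finally show ?thesis using K.poly_ring_mult_var[OF p] by simp
  qed
  show "?h \<in> ring_hom ?P A"
  proof (rule ring_hom_memI)
    fix p q assume p: "p \<in> carrier ?P" and q: "q \<in> carrier ?P"
    have C: "K.indexed_const k \<otimes>\<^bsub>?P\<^esub> K.indexed_const l = (K.indexed_const (k \<otimes>\<^bsub>K\<^esub> l) :: 'c multiset \<Rightarrow> 'k)"
      if "k \<in> carrier K" "l \<in> carrier K" for k l
      by (rule ring_hom_mult[OF K.indexed_const_hom that, symmetric])
    \<comment> \<open>This is the base case of the induction on \<open>p\<close> below, and it needs
      its own induction on the other factor \<open>q\<close>.\<close>
    have const_mult: "?h (q \<otimes>\<^bsub>?P\<^esub> K.indexed_const k) = ?h q \<otimes>\<^bsub>A\<^esub> \<alpha> k" if k: "k \<in> carrier K" for k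
      using q
    proof (induction rule: K.poly_ring_induct)
      case (const l)
      then show ?case using k by (simp add: C h_const)
    next
      case (add p q)
      then show ?case using k closed
        by (simp add: P.l_distr K.indexed_const_mem h_add A.l_distr)
    next
      case (var p i)
      have "p \<otimes>\<^bsub>?P\<^esub> K.indexed_var i \<otimes>\<^bsub>?P\<^esub> K.indexed_const k =
            p \<otimes>\<^bsub>?P\<^esub> K.indexed_const k \<otimes>\<^bsub>?P\<^esub> K.indexed_var i"
        using var(1) K.indexed_const_mem[OF k, of I] K.indexed_var_mem[OF var(2)] by (simp add: P.m_ac)
      with var k closed c show ?case
        by (simp add: h_var K.indexed_const_mem A.m_ac)
    qed
    show "?h (p \<otimes>\<^bsub>?P\<^esub> q) = ?h p \<otimes>\<^bsub>A\<^esub> ?h q"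
      using p
    proof (induction rule: K.poly_ring_induct)
      case (const l)
      then show ?case using q const_mult h_const closed
        by (simp add: P.m_comm[of _ q] K.indexed_const_mem A.m_comm)
    next
      case (add p p')
      then show ?case using q closed
        by (simp add: P.l_distr h_add A.l_distr)
    next
      case (var p i)
      have "p \<otimes>\<^bsub>?P\<^esub> K.indexed_var i \<otimes>\<^bsub>?P\<^esub> q = p \<otimes>\<^bsub>?P\<^esub> q \<otimes>\<^bsub>?P\<^esub> K.indexed_var i"
        using var(1) q K.indexed_var_mem[OF var(2)] by (simp add: P.m_ac)
      with var q closed c show ?case
        by (simp add: h_var A.m_ac)
    qed
  next
    have "\<one>\<^bsub>?P\<^esub> = K.indexed_const \<one>\<^bsub>K\<^esub>" by (simp add: poly_ring_def)
    then show "?h \<one>\<^bsub>?P\<^esub> = \<one>\<^bsub>A\<^esub>" by (simp add: h_const)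
  qed (use closed h_add in auto)
  show "?h (K.indexed_const k) = \<alpha> k" if "k \<in> carrier K" for k using h_const that .
  \<comment> \<open>An indeterminate is the unit polynomial times itself, so \<open>h_var\<close> at
    the unit gives its value.\<close>
  show "?h (K.indexed_var i) = c i" for i
  proof -
    have one: "\<one>\<^bsub>?P\<^esub> = K.indexed_const \<one>\<^bsub>K\<^esub>" by (simp add: poly_ring_def)
    have "\<one>\<^bsub>?P\<^esub> \<otimes>\<^bsub>?P\<^esub> K.indexed_var i = K.indexed_var i"
      unfolding K.poly_ring_mult_var[OF P.one_closed] by (simp add: one K.indexed_var_def)
    moreover have "?h \<one>\<^bsub>?P\<^esub> = \<one>\<^bsub>A\<^esub>" by (simp add: one h_const)
    ultimately show ?thesis using h_var[OF P.one_closed, of i] c by simp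
  qed
qed

section \<open>Quotients and homomorphisms\<close>

lemma ring_hom_cringI_mem: "cring R \<Longrightarrow> cring S \<Longrightarrow> h \<in> ring_hom R S \<Longrightarrow> ring_hom_cring R S h"
  by (simp add: ring_hom_cring_def ring_hom_cring_axioms_def)

text \<open>The kernel is an ideal containing the generators, hence contains the ideal they
  generate.\<close>

lemma ring_hom_genideal_zero:
  assumes R: "ring R" and S: "ring S" and h: "h \<in> ring_hom R S"
    and B: "B \<subseteq> carrier R" and "\<And>x. x \<in> B \<Longrightarrow> h x = \<zero>\<^bsub>S\<^esub>" and "y \<in> Idl\<^bsub>R\<^esub> B"
  shows "h y = \<zero>\<^bsub>S\<^esub>"
proof -
  interpret h: ring_hom_ring R S h using R S h by (simp add: ring_hom_ringI2)
  have "B \<subseteq> a_kernel R S h"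
  proof
    fix x assume "x \<in> B"
    with B assms(5) show "x \<in> a_kernel R S h" unfolding a_kernel_def' by blast
  qed
  then have "Idl\<^bsub>R\<^esub> B \<subseteq> a_kernel R S h"
    by (rule h.R.genideal_minimal[OF h.kernel_is_ideal])
  with assms(6) show ?thesis unfolding a_kernel_def' by blast
qed

lemma carrier_Quot: "carrier (R Quot I) = (\<lambda>x. I +>\<^bsub>R\<^esub> x) ` carrier R"
  by (auto simp: FactRing_def A_RCOSETS_def')

lemma (in ideal) Quot_lift:
  assumes S: "ring S" and h: "h \<in> ring_hom R S" and zero: "\<And>x. x \<in> I \<Longrightarrow> h x = \<zero>\<^bsub>S\<^esub>"
  obtains g where "g \<in> ring_hom (R Quot I) S" "\<And>x. x \<in> carrier R \<Longrightarrow> g (I +> x) = h x"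
proof -
  interpret h: ring_hom_ring R S h using S h ring_axioms by (simp add: ring_hom_ringI2)
  \<comment> \<open>A coset is evaluated at a chosen representative. The choice does not matter: two
    representatives differ by an element of \<open>I\<close>, which \<open>h\<close> kills.\<close>
  define g where "g U = h (SOME x. x \<in> U)" for U
  have g: "g (I +> x) = h x" if x: "x \<in> carrier R" for x
  proof -
    let ?y = "SOME y. y \<in> I +> x"
    have y: "?y \<in> I +> x" using a_rcos_self[OF x] by (rule someI)
    then obtain a where a: "a \<in> I" "?y = a \<oplus> x" by (auto simp: a_r_coset_def')
    then show ?thesis using x zero[OF a(1)] by (simp add: g_def a_Hcarr)
  qed
  interpret q: ring_hom_ring R "R Quot I" "(+>) I" by (rule rcos_ring_hom_ring)
  have "g \<in> ring_hom (R Quot I) S"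
  proof (rule ring_hom_memI)
    fix U V assume "U \<in> carrier (R Quot I)" "V \<in> carrier (R Quot I)"
    then obtain x y where xy: "U = I +> x" "V = I +> y" "x \<in> carrier R" "y \<in> carrier R"
      by (auto simp: carrier_Quot)
    then show "g (U \<otimes>\<^bsub>R Quot I\<^esub> V) = g U \<otimes>\<^bsub>S\<^esub> g V" "g (U \<oplus>\<^bsub>R Quot I\<^esub> V) = g U \<oplus>\<^bsub>S\<^esub> g V"
      by (simp_all only: g q.hom_mult[symmetric] q.hom_add[symmetric] m_closed a_closed h.hom_mult h.hom_add)
  next
    show "g \<one>\<^bsub>R Quot I\<^esub> = \<one>\<^bsub>S\<^esub>" by (simp only: g q.hom_one[symmetric] one_closed h.hom_one)
  qed (auto simp: carrier_Quot g)
  with g show thesis using that by blast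
qed

section \<open>Continuants\<close>

definition mat2_map :: "('a \<Rightarrow> 'b) \<Rightarrow> 'a mat2 \<Rightarrow> 'b mat2"
  where "mat2_map h M = Mat2 (h (e11 M)) (h (e12 M)) (h (e21 M)) (h (e22 M))"

text \<open>The length \<open>m\<close> is shifted by one: \<open>continuant A c i m\<close> is the determinant of the tridiagonal
  matrix with diagonal $c_i, \dots, c_{i+m-2}$, so that $P_{i,j}$ corresponds to
  \<open>continuant A c i (j - i)\<close>, also for $i = j$.\<close>

fun continuant :: "('a, 'b) ring_scheme \<Rightarrow> (nat \<Rightarrow> 'a) \<Rightarrow> nat \<Rightarrow> nat \<Rightarrow> 'a" where
  "continuant A c i 0 = \<zero>\<^bsub>A\<^esub>"
| "continuant A c i (Suc 0) = \<one>\<^bsub>A\<^esub>"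
| "continuant A c i (Suc (Suc m)) = c (i + m) \<otimes>\<^bsub>A\<^esub> continuant A c i (Suc m) \<ominus>\<^bsub>A\<^esub> continuant A c i m"

context cring
begin

lemma eta_prod_closed:
  assumes "\<And>j. i \<le> j \<Longrightarrow> j < i + m \<Longrightarrow> c j \<in> carrier R"
  shows "e11 (eta_prod R c i m) \<in> carrier R \<and> e12 (eta_prod R c i m) \<in> carrier R \<and>
    e21 (eta_prod R c i m) \<in> carrier R \<and> e22 (eta_prod R c i m) \<in> carrier R"
  using assms by (induction m) (auto simp: mat2_mult_def eta_def mat2_one_def)

lemma eta_prod_hom:
  assumes "ring_hom_cring S R h" "\<And>j. i \<le> j \<Longrightarrow> j < i + m \<Longrightarrow> c j \<in> carrier S"
  shows "mat2_map h (eta_prod S c i m) = eta_prod R (\<lambda>j. h (c j)) i m"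
proof -
  interpret h: ring_hom_cring S R h by fact
  show ?thesis using assms(2)
  proof (induction m)
    case 0
    then show ?case by (simp add: mat2_map_def mat2_one_def)
  next
    case (Suc m)
    have "mat2_map h (eta_prod S c i m) = eta_prod R (\<lambda>j. h (c j)) i m"
      by (rule Suc.IH) (use Suc.prems in auto)
    then show ?case
      using h.R.eta_prod_closed[of i m c] Suc.prems
      by (auto simp: mat2_map_def mat2_mult_def eta_def simp flip: \<open>_ = eta_prod R _ i m\<close>)
  qed
qed

lemma eta_prod_cong:
  "(\<And>j. i \<le> j \<Longrightarrow> j < i + m \<Longrightarrow> c j = c' j) \<Longrightarrow> eta_prod R c i m = eta_prod R c' i m"
  by (induction m) auto

lemma continuant_closed [simp]:
  "(\<And>j. i \<le> j \<Longrightarrow> j + 1 < i + m \<Longrightarrow> c j \<in> carrier R) \<Longrightarrow> continuant R c i m \<in> carrier R"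
  by (induction m rule: induct_nat_012) auto

lemma continuant_hom:
  assumes "ring_hom_cring S R h" "\<And>j. i \<le> j \<Longrightarrow> j + 1 < i + m \<Longrightarrow> c j \<in> carrier S"
  shows "h (continuant S c i m) = continuant R (\<lambda>j. h (c j)) i m"
proof -
  interpret h: ring_hom_cring S R h by fact
  show ?thesis using assms(2)
    by (induction m rule: induct_nat_012) (auto simp: a_minus_def h.R.continuant_closed)
qed

text \<open>Multiplying by one more eta from the left applies the continuant recursion to the first
  row and moves the old first row down. The empty product is excluded: its lower right entry 1 would
  call for a continuant of length -1.\<close>

lemma eta_prod_Suc:
  assumes "\<And>j. i \<le> j \<Longrightarrow> j \<le> i + m \<Longrightarrow> c j \<in> carrier R"
  shows "eta_prod R c i (Suc m) =
    Mat2 (continuant R c i (m + 2)) (\<ominus> continuant R c (Suc i) (m + 1))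
         (continuant R c i (m + 1)) (\<ominus> continuant R c (Suc i) m)"
  using assms
proof (induction m)
  case 0
  then show ?case by (simp add: mat2_mult_def eta_def mat2_one_def a_minus_def)
next
  case (Suc m)
  have c: "continuant R c i k \<in> carrier R" "continuant R c (Suc i) l \<in> carrier R"
    if "k \<le> m + 2" "l \<le> m + 2" for k l
    by (rule continuant_closed, use Suc.prems that in auto)+
  have e: "eta_prod R c i (Suc m) =
    Mat2 (continuant R c i (m + 2)) (\<ominus> continuant R c (Suc i) (m + 1))
         (continuant R c i (m + 1)) (\<ominus> continuant R c (Suc i) m)"
    by (rule Suc.IH) (use Suc.prems in auto)
  show ?case
    unfolding eta_prod.simps(2)[of R c i "Suc m"] e
    using c[of "m+2" "m+1"] c[of "m+1" m] c[of "m+2" "m+2"] Suc.prems[of "Suc (i + m)"]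
    by (simp add: mat2_mult_def eta_def a_minus_def l_minus r_minus minus_add)
qed

text \<open>Unlike the closed form of the whole matrix, the formula for this entry also covers the
  empty product; it translates the prescribed inverse into continuants.\<close>

lemma e11_eta_prod:
  assumes "\<And>j. i \<le> j \<Longrightarrow> j < i + m \<Longrightarrow> c j \<in> carrier R"
  shows "e11 (eta_prod R c i m) = continuant R c i (Suc m)"
proof (cases m)
  case 0
  then show ?thesis by (simp add: mat2_one_def)
next
  case (Suc k)
  then show ?thesis using assms eta_prod_Suc[of i k c] by simp
qed

text \<open>For $j = i + a$, $k = j + b$, $l = k + d$ this is the Pluecker relation. Both sides satisfy the same
  second-order linear recursion in \<open>d\<close>, so it suffices to check \<open>d = 0\<close> and \<open>d = 1\<close>; the latter is
  proved by a similar recursion in \<open>b\<close>.\<close>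

lemma continuant_euler:
  assumes c: "\<And>j. i \<le> j \<Longrightarrow> j + 1 < i + a + b + d \<Longrightarrow> c j \<in> carrier R"
  shows "continuant R c i (a + b) \<otimes> continuant R c (i + a) (b + d) =
     continuant R c i a \<otimes> continuant R c (i + a + b) d \<oplus> continuant R c i (a + b + d) \<otimes> continuant R c (i + a) b"
proof -
  \<comment> \<open>The case \<open>d = 1\<close>, where the continuant
    \<open>continuant R c (i + a + b) d\<close> is 1.\<close>
  have one: "continuant R c i (a + b') \<otimes> continuant R c (i + a) (Suc b') =
      continuant R c i a \<oplus> continuant R c i (Suc (a + b')) \<otimes> continuant R c (i + a) b'"
    if "\<And>j. i \<le> j \<Longrightarrow> j < i + a + b' \<Longrightarrow> c j \<in> carrier R" for b'
    using that
  proof (induction b')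
    case 0
    have "continuant R c i a \<in> carrier R" "continuant R c i (Suc a) \<in> carrier R"
      by (rule continuant_closed, use 0 in auto)+
    then show ?case by simp
  next
    case (Suc k)
    \<comment> \<open>With \<open>x\<close> the newly adjoined entry of \<open>c\<close>, both sides
      of the new identity contain the term \<open>x w v\<close>; what remains after removing it is
      the induction hypothesis \<open>u v = p + w t\<close>.\<close>
    have "x \<in> carrier R \<Longrightarrow> u \<in> carrier R \<Longrightarrow> v \<in> carrier R \<Longrightarrow> p \<in> carrier R \<Longrightarrow> w \<in> carrier R \<Longrightarrow>
        t \<in> carrier R \<Longrightarrow> u \<otimes> v = p \<oplus> w \<otimes> t \<Longrightarrow>
        w \<otimes> (x \<otimes> v \<ominus> t) = p \<oplus> (x \<otimes> w \<ominus> u) \<otimes> v" for x u v p w t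
    proof -
      assume *: "x \<in> carrier R" "u \<in> carrier R" "v \<in> carrier R" "p \<in> carrier R" "w \<in> carrier R"
        "t \<in> carrier R" "u \<otimes> v = p \<oplus> w \<otimes> t"
      have "w \<otimes> (x \<otimes> v \<ominus> t) = p \<oplus> x \<otimes> w \<otimes> v \<ominus> (p \<oplus> w \<otimes> t)"
        using *(1-6) by algebra
      also have "\<dots> = p \<oplus> x \<otimes> w \<otimes> v \<ominus> u \<otimes> v" using * by simp
      also have "\<dots> = p \<oplus> (x \<otimes> w \<ominus> u) \<otimes> v" using *(1-6) by algebra
      finally show ?thesis .
    qed
    note step = this
    have IH: "continuant R c i (a + k) \<otimes> continuant R c (i + a) (Suc k) =
        continuant R c i a \<oplus> continuant R c i (Suc (a + k)) \<otimes> continuant R c (i + a) k"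
      by (rule Suc.IH) (use Suc.prems in auto)
    have "continuant R c i (Suc (a + k)) \<otimes> (c (i + a + k) \<otimes> continuant R c (i + a) (Suc k) \<ominus> continuant R c (i + a) k) =
        continuant R c i a \<oplus> (c (i + a + k) \<otimes> continuant R c i (Suc (a + k)) \<ominus> continuant R c i (a + k)) \<otimes> continuant R c (i + a) (Suc k)"
      by (rule step[OF _ _ _ _ _ _ IH]; (rule continuant_closed)?) (use Suc.prems in auto)
    then show ?case by (simp add: add.assoc)
  qed
  show ?thesis
    using c
  proof (induction d rule: induct_nat_012)
    case 0
    then show ?case by simp
  next
    case 1
    then show ?case using one[of b] by simp
  next
    case (ge2 d)
    \<comment> \<open>Linearity in the last argument: the new identity is \<open>x\<close> times the
      hypothesis for \<open>Suc d\<close> minus the hypothesis for \<open>d\<close>.\<close>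
    have "x \<in> carrier R \<Longrightarrow> u \<in> carrier R \<Longrightarrow> p \<in> carrier R \<Longrightarrow> t \<in> carrier R \<Longrightarrow>
        v \<in> carrier R \<Longrightarrow> q \<in> carrier R \<Longrightarrow> w \<in> carrier R \<Longrightarrow>
        v' \<in> carrier R \<Longrightarrow> q' \<in> carrier R \<Longrightarrow> w' \<in> carrier R \<Longrightarrow>
        u \<otimes> v = p \<otimes> q \<oplus> w \<otimes> t \<Longrightarrow> u \<otimes> v' = p \<otimes> q' \<oplus> w' \<otimes> t \<Longrightarrow>
        u \<otimes> (x \<otimes> v' \<ominus> v) = p \<otimes> (x \<otimes> q' \<ominus> q) \<oplus> (x \<otimes> w' \<ominus> w) \<otimes> t"
      for x u p t v q w v' q' w'
    proof -
      assume *: "x \<in> carrier R" "u \<in> carrier R" "p \<in> carrier R" "t \<in> carrier R"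
        "v \<in> carrier R" "q \<in> carrier R" "w \<in> carrier R"
        "v' \<in> carrier R" "q' \<in> carrier R" "w' \<in> carrier R"
        "u \<otimes> v = p \<otimes> q \<oplus> w \<otimes> t" "u \<otimes> v' = p \<otimes> q' \<oplus> w' \<otimes> t"
      have "u \<otimes> (x \<otimes> v' \<ominus> v) = x \<otimes> (u \<otimes> v') \<ominus> u \<otimes> v"
        using *(1-10) by algebra
      also have "\<dots> = x \<otimes> (p \<otimes> q' \<oplus> w' \<otimes> t) \<ominus> (p \<otimes> q \<oplus> w \<otimes> t)" using *(11,12) by simp
      also have "\<dots> = p \<otimes> (x \<otimes> q' \<ominus> q) \<oplus> (x \<otimes> w' \<ominus> w) \<otimes> t" using *(1-10) by algebra
      finally show ?thesis .
    qed
    note step = this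
    have IH: "continuant R c i (a + b) \<otimes> continuant R c (i + a) (b + d) =
        continuant R c i a \<otimes> continuant R c (i + a + b) d \<oplus> continuant R c i (a + b + d) \<otimes> continuant R c (i + a) b"
      "continuant R c i (a + b) \<otimes> continuant R c (i + a) (b + Suc d) =
        continuant R c i a \<otimes> continuant R c (i + a + b) (Suc d) \<oplus>
        continuant R c i (a + b + Suc d) \<otimes> continuant R c (i + a) b"
      by (rule ge2.IH; use ge2.prems in auto)+
    have "continuant R c i (a + b) \<otimes>
        (c (i + a + b + d) \<otimes> continuant R c (i + a) (b + Suc d) \<ominus> continuant R c (i + a) (b + d)) =
        continuant R c i a \<otimes>
        (c (i + a + b + d) \<otimes> continuant R c (i + a + b) (Suc d) \<ominus> continuant R c (i + a + b) d) \<oplus>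
        (c (i + a + b + d) \<otimes> continuant R c i (a + b + Suc d) \<ominus> continuant R c i (a + b + d)) \<otimes> continuant R c (i + a) b"
      by (rule step[OF _ _ _ _ _ _ _ _ _ _ IH]; (rule continuant_closed)?) (use ge2.prems in auto)
    then show ?case by (simp add: add.assoc)
  qed
qed

section \<open>The matrix equation and the closing conditions on continuants\<close>

text \<open>The recursion is run backwards from the prescribed entries. Starting at 1, length n+1
  gives -1 and length n gives 0, which forces length n-1 to be 1 and then length n-2 to be c_{n-1};
  starting at 2, lengths n and n-1 give 0 and 1, which yields c_n. The three conclusions are the
  images of P_{1,n} = 1, P_{n-1,n+1} = P_{1,n-1} and P_{n,n+2} = P_{2,n}.\<close>

lemma continuant_of_eta_prod_eq_minus_one:
  assumes n: "n \<ge> 3" and c: "\<And>j. 1 \<le> j \<Longrightarrow> j \<le> n \<Longrightarrow> c j \<in> carrier R"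
    and M: "M = mat2_add R (eta_prod R c 1 n) (mat2_one R)"
    and zero: "e11 M = \<zero>" "e12 M = \<zero>" "e21 M = \<zero>" "e22 M = \<zero>"
  shows "continuant R c 1 (n - 1) = \<one>" and "continuant R c 1 (n - 2) = c (n - 1)" and "continuant R c 2 (n - 2) = c n"
proof -
  \<comment> \<open>With \<open>k = n - 3\<close> all lengths become sums, so the continuant
    recursion unfolds without truncated subtraction: \<open>k + 4\<close> is n+1, and
    \<open>k + 1\<close> is n-2.\<close>
  obtain k where k: "n = Suc (Suc (Suc k))" using n
    by (metis Suc_le_D numeral_3_eq_3 Suc_le_mono)
  have cc: "continuant R c 1 m \<in> carrier R" if "m \<le> k + 4" for m
    by (rule continuant_closed) (use c that k in auto)
  have cc2: "continuant R c 2 m \<in> carrier R" if "m \<le> k + 3" for m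
    by (rule continuant_closed) (use c that k in auto)
  have "eta_prod R c 1 (Suc (k + 2)) = Mat2 (continuant R c 1 (k + 2 + 2)) (\<ominus> continuant R c (Suc 1) (k + 2 + 1))
      (continuant R c 1 (k + 2 + 1)) (\<ominus> continuant R c (Suc 1) (k + 2))"
    by (rule eta_prod_Suc) (use c k in auto)
  then have e: "eta_prod R c 1 n = Mat2 (continuant R c 1 (k + 4)) (\<ominus> continuant R c 2 (k + 3))
      (continuant R c 1 (k + 3)) (\<ominus> continuant R c 2 (k + 2))"
    by (simp add: k numeral_eq_Suc)
  have z1: "continuant R c 1 (k + 4) \<oplus> \<one> = \<zero>" and z2: "\<ominus> continuant R c 2 (k + 3) = \<zero>"
    and z3: "continuant R c 1 (k + 3) = \<zero>" and z4: "\<ominus> continuant R c 2 (k + 2) \<oplus> \<one> = \<zero>"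
    using zero cc[of "k+3"] cc2[of "k+3"]
    unfolding M e by (simp_all add: mat2_add_def mat2_one_def)
  have r1: "continuant R c 1 (k + 4) = c n \<otimes> continuant R c 1 (k + 3) \<ominus> continuant R c 1 (k + 2)"
    and r2: "continuant R c 1 (k + 3) = c (n - 1) \<otimes> continuant R c 1 (k + 2) \<ominus> continuant R c 1 (k + 1)"
    and r3: "continuant R c 2 (k + 3) = c n \<otimes> continuant R c 2 (k + 2) \<ominus> continuant R c 2 (k + 1)"
    by (simp_all add: k numeral_eq_Suc)
  have cn: "c n \<in> carrier R" "c (n - 1) \<in> carrier R" using c n by auto
  have minus_one_eq: "x = \<one>" if "\<ominus> x \<oplus> \<one> = \<zero>" "x \<in> carrier R" for x
  proof -
    have "\<one> \<ominus> x = \<zero>" using that by (simp add: a_minus_def a_comm)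
    then show ?thesis using that by simp
  qed
  have "\<ominus> continuant R c 1 (k + 2) \<oplus> \<one> = \<zero>"
    using z1 cc[of "k + 2"] cn unfolding r1 z3 by (simp add: a_minus_def del: continuant.simps)
  then have a: "continuant R c 1 (k + 2) = \<one>"
    using minus_one_eq cc[of "k + 2"] by (simp del: continuant.simps)
  then show "continuant R c 1 (n - 1) = \<one>" by (simp add: k)
  have "c (n - 1) \<ominus> continuant R c 1 (k + 1) = \<zero>" using z3 cn unfolding r2 a by (simp del: continuant.simps)
  then show "continuant R c 1 (n - 2) = c (n - 1)"
    using cn cc[of "k+1"] by (simp add: k r_right_minus_eq)
  have b: "continuant R c 2 (k + 2) = \<one>"
    using minus_one_eq z4 cc2[of "k + 2"] by (simp del: continuant.simps)
  have "continuant R c 2 (k + 3) = \<zero>"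
    using z2 cc2[of "k+3"] by (metis minus_minus minus_zero order_refl)
  then have "c n \<ominus> continuant R c 2 (k + 1) = \<zero>" using b cn r3 by simp
  then show "continuant R c 2 (n - 2) = c n"
    using cn cc2[of "k+1"] by (simp add: k r_right_minus_eq)
qed

text \<open>Stated for an abstract family \<open>p\<close> on the pairs i < j \<le> n. The entries
  of \<open>c\<close> are constrained only up to index n-2, so the wrapped values play no part in
  this identification.\<close>

lemma continuant_plucker:
  assumes p: "\<And>i j. 1 \<le> i \<Longrightarrow> i < j \<Longrightarrow> j \<le> n \<Longrightarrow> p i j \<in> carrier R"
    and plucker: "\<And>i j k l. 1 \<le> i \<Longrightarrow> i < j \<Longrightarrow> j < k \<Longrightarrow> k < l \<Longrightarrow> l \<le> n \<Longrightarrow>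
      p i k \<otimes> p j l = p i j \<otimes> p k l \<oplus> p i l \<otimes> p j k"
    and one: "\<And>i. 1 \<le> i \<Longrightarrow> i + 1 \<le> n \<Longrightarrow> p i (i + 1) = \<one>"
    and c: "\<And>i. 1 \<le> i \<Longrightarrow> i + 2 \<le> n \<Longrightarrow> c i = p i (i + 2)"
    and i: "1 \<le> i" "0 < m" "i + m \<le> n"
  shows "continuant R c i m = p i (i + m)"
  using i(2,3)
proof (induction m rule: induct_nat_012)
  case 1
  then show ?case using one[of i] i by simp
next
  case (ge2 m)
  have pc: "p i (i + m + 1) \<in> carrier R" "c (i + m) \<in> carrier R" "p i (i + m + 2) \<in> carrier R"
    using p c ge2.prems i by auto
  show ?case
  \<comment> \<open>For \<open>m = 0\<close> the first two of the four indices i, i+m, i+m+1, i+m+2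
    coincide, so there is no Pluecker relation; the continuant of length 2 is then
    \<open>c i\<close> itself.\<close>
  proof (cases "m = 0")
    case True
    then show ?thesis using c[of i] ge2.prems i pc by (simp add: a_minus_def)
  next
    case False
    have IH: "continuant R c i m = p i (i + m)" "continuant R c i (Suc m) = p i (i + m + 1)"
      using ge2.IH ge2.prems False by auto
    have pm: "p i (i + m) \<in> carrier R" using p ge2.prems i False by auto
    have "p i (i + m + 1) \<otimes> p (i + m) (i + m + 2) =
        p i (i + m) \<otimes> p (i + m + 1) (i + m + 2) \<oplus> p i (i + m + 2) \<otimes> p (i + m) (i + m + 1)"
      by (rule plucker) (use ge2.prems i False in auto)
    then have "p i (i + m + 1) \<otimes> c (i + m) = p i (i + m) \<oplus> p i (i + m + 2)"
      using c[of "i + m"] one[of "i + m"] one[of "i + m + 1"] ge2.prems i pc pm by simp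
    then have "c (i + m) \<otimes> p i (i + m + 1) \<ominus> p i (i + m) = p i (i + m + 2)"
      using pc pm by (simp add: m_comm[of "c (i+m)"]) algebra
    then show ?thesis using IH by simp
  qed
qed simp

text \<open>Converse of the backward computation above: the known values at lengths up to n-1 (start
  1) and n-2 (start 2) are pushed forward through the recursion to the four entries.\<close>

lemma eta_prod_plucker:
  assumes n: "n \<ge> 3"
    and p: "\<And>i j. 1 \<le> i \<Longrightarrow> i < j \<Longrightarrow> j \<le> n \<Longrightarrow> p i j \<in> carrier R"
    and plucker: "\<And>i j k l. 1 \<le> i \<Longrightarrow> i < j \<Longrightarrow> j < k \<Longrightarrow> k < l \<Longrightarrow> l \<le> n \<Longrightarrow>
      p i k \<otimes> p j l = p i j \<otimes> p k l \<oplus> p i l \<otimes> p j k"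
    and one: "\<And>i. 1 \<le> i \<Longrightarrow> i + 1 \<le> n \<Longrightarrow> p i (i + 1) = \<one>" "p 1 n = \<one>"
    and c: "\<And>i. 1 \<le> i \<Longrightarrow> i + 2 \<le> n \<Longrightarrow> c i = p i (i + 2)" "c (n - 1) = p 1 (n - 1)" "c n = p 2 n"
  shows "eta_prod R c 1 n = Mat2 (\<ominus> \<one>) \<zero> \<zero> (\<ominus> \<one>)"
proof -
  obtain k where k: "n = Suc (Suc (Suc k))" using n
    by (metis Suc_le_D numeral_3_eq_3 Suc_le_mono)
  have cn: "c i \<in> carrier R" if i: "1 \<le> i" "i \<le> n" for i
  proof -
    \<comment> \<open>The last two entries of \<open>c\<close> lie beyond the range where
      \<open>c i = p i (i + 2)\<close> applies and are given by the wrapped values.\<close>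
    have "i + 2 \<le> n \<or> i = n - 1 \<or> i = n" using i by arith
    then show ?thesis using c p[of i "i+2"] p[of 1 "n - 1"] p[of 2 n] i n by auto
  qed
  have cp: "continuant R c i m = p i (i + m)" if "1 \<le> i" "0 < m" "i + m \<le> n" for i m
    by (rule continuant_plucker[where n = n]) (use assms that in auto)
  have "eta_prod R c 1 (Suc (k + 2)) = Mat2 (continuant R c 1 (k + 2 + 2)) (\<ominus> continuant R c (Suc 1) (k + 2 + 1))
      (continuant R c 1 (k + 2 + 1)) (\<ominus> continuant R c (Suc 1) (k + 2))"
    by (rule eta_prod_Suc) (use cn k in auto)
  then have e: "eta_prod R c 1 n = Mat2 (continuant R c 1 (k + 4)) (\<ominus> continuant R c 2 (k + 3))
      (continuant R c 1 (k + 3)) (\<ominus> continuant R c 2 (k + 2))"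
    by (simp add: k numeral_eq_Suc)
  have r1: "continuant R c 1 (k + 4) = c n \<otimes> continuant R c 1 (k + 3) \<ominus> continuant R c 1 (k + 2)"
    and r2: "continuant R c 1 (k + 3) = c (n - 1) \<otimes> continuant R c 1 (k + 2) \<ominus> continuant R c 1 (k + 1)"
    and r3: "continuant R c 2 (k + 3) = c n \<otimes> continuant R c 2 (k + 2) \<ominus> continuant R c 2 (k + 1)"
    and r4: "continuant R c 2 (k + 2) = c (n - 1) \<otimes> continuant R c 2 (k + 1) \<ominus> continuant R c 2 k"
    by (simp_all add: k numeral_eq_Suc)
  have cl: "c n \<in> carrier R" "c (n - 1) \<in> carrier R" using cn n by auto
  have a: "continuant R c 1 (k + 2) = \<one>" using cp[of 1 "k + 2"] one by (simp add: k)
  have a': "continuant R c 1 (k + 1) = c (n - 1)" using cp[of 1 "k + 1"] c by (simp add: k)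
  have b: "continuant R c 2 (k + 1) = c n" using cp[of 2 "k + 1"] c by (simp add: k)
  have z3: "continuant R c 1 (k + 3) = \<zero>" using r2 a a' cl by (simp add: r_neg a_minus_def)
  have z1: "continuant R c 1 (k + 4) = \<ominus> \<one>" using r1 a z3 cl by (simp add: a_minus_def)
  \<comment> \<open>The recursion reduces this to c_{n-1} c_n = 1 + P_{2,n-1}, which is the Pluecker
    relation on 1, 2, n-1, n. For n = 3 the indices 2 and n-1 coincide, but then c_2 = c_3 = 1
    because they are P_{1,2} and P_{2,3}.\<close>
  have z4: "continuant R c 2 (k + 2) = \<one>"
  proof (cases "k = 0")
    case True
    then have "n = 3" by (simp add: k)
    have "c (n - 1) = \<one>" "c n = \<one>" using c one(1)[of 1] one(1)[of 2] \<open>n = 3\<close> by (auto simp: numeral_2_eq_2 numeral_3_eq_3)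
    then show ?thesis unfolding r4 b using True by (simp add: a_minus_def)
  next
    case False
    have "p 1 (n - 1) \<otimes> p 2 n = p 1 2 \<otimes> p (n - 1) n \<oplus> p 1 n \<otimes> p 2 (n - 1)"
      by (rule plucker) (use k False in auto)
    moreover have "p 1 2 = \<one>" "p (n - 1) n = \<one>" using one(1)[of 1] one(1)[of "n - 1"] k
      by (auto simp: numeral_eq_Suc)
    moreover have "continuant R c 2 k = p 2 (n - 1)" using cp[of 2 k] False by (simp add: k)
    moreover have "p 2 (n - 1) \<in> carrier R" using p k False by auto
    ultimately have "c (n - 1) \<otimes> c n = \<one> \<oplus> continuant R c 2 k" "continuant R c 2 k \<in> carrier R"
      using one(2) c by simp_all
    then show ?thesis unfolding r4 b by (simp add: a_minus_def a_assoc r_neg)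
  qed
  have z2: "continuant R c 2 (k + 3) = \<zero>" using r3 z4 b cl by (simp add: r_neg a_minus_def)
  show ?thesis unfolding e z1 z2 z3 z4 by simp
qed

end

section \<open>Presentations of the two rings\<close>

lemma red_index_id:
  assumes "1 \<le> i" "i \<le> n"
  shows "red_index n i = i"
proof -
  from assms obtain j where "i = Suc j" "j < n" by (cases i) auto
  then show ?thesis by (simp add: red_index_def)
qed

lemma red_index_add:
  assumes "1 \<le> i" "i \<le> n"
  shows "red_index n (n + i) = i"
proof -
  from assms obtain j where j: "i = Suc j" "j < n" by (cases i) auto
  then have "n + i + (n - 1) = j + 2 * n" by simp
  with j show ?thesis by (simp only: red_index_def) simp
qed

section \<open>The quotient R/J and its universal property\<close>

locale frieze_ring = K: cring K for K :: "('k, 'b) ring_scheme" +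
  fixes n :: nat
  assumes n: "n \<ge> 3"
begin

abbreviation "c\<^sub>R i \<equiv> class_J K n (K.indexed_var i)"

text \<open>The composite of both quotient maps: it makes the two-step quotient accessible as an
  image of a single polynomial ring.\<close>

definition proj_G :: "((nat \<times> nat) multiset \<Rightarrow> 'k) \<Rightarrow> ((nat \<times> nat) multiset \<Rightarrow> 'k) set set"
  where "proj_G p = frieze_ideal K n +>\<^bsub>O_Gr K n\<^esub> (plu_ideal K n +>\<^bsub>plu_ring K n\<^esub> p)"

sublocale R: cring "ring_R K n"
  unfolding ring_R_def by (rule K.poly_ring_cring)

sublocale P: cring "plu_ring K n"
  unfolding plu_ring_def by (rule K.poly_ring_cring)

lemma var_R_mem: "1 \<le> i \<Longrightarrow> i \<le> n \<Longrightarrow> K.indexed_var i \<in> carrier (ring_R K n)"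
  unfolding ring_R_def by (rule K.indexed_var_mem) auto

definition M_J where
  "M_J = mat2_add (ring_R K n) (eta_prod (ring_R K n) K.indexed_var 1 n) (mat2_one (ring_R K n))"

lemma M_J_mem: "{e11 M_J, e12 M_J, e21 M_J, e22 M_J} \<subseteq> carrier (ring_R K n)"
  using R.eta_prod_closed[of 1 n "K.indexed_var"] var_R_mem
  by (auto simp: M_J_def mat2_add_def mat2_one_def)

lemma ideal_J_eq: "ideal_J K n = Idl\<^bsub>ring_R K n\<^esub> {e11 M_J, e12 M_J, e21 M_J, e22 M_J}"
  by (simp add: ideal_J_def M_J_def Let_def)

sublocale J: ideal "ideal_J K n" "ring_R K n"
  unfolding ideal_J_eq by (rule R.genideal_ideal[OF M_J_mem])

sublocale Q: cring "R_mod_J K n"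
  unfolding R_mod_J_def by (rule J.quotient_is_cring[OF R.is_cring])

lemma class_J_hom: "class_J K n \<in> ring_hom (ring_R K n) (R_mod_J K n)"
  using J.rcos_ring_hom by (simp add: class_J_def[abs_def] R_mod_J_def)

lemma class_J_zero: "x \<in> ideal_J K n \<Longrightarrow> class_J K n x = \<zero>\<^bsub>R_mod_J K n\<^esub>"
  by (simp add: class_J_def R_mod_J_def FactRing_def J.a_rcos_const)

lemma const_R_mem: "k \<in> carrier K \<Longrightarrow> K.indexed_const k \<in> carrier (ring_R K n)"
  unfolding ring_R_def by (rule K.indexed_const_mem)

lemma const_J_hom: "const_J K n \<in> ring_hom K (R_mod_J K n)"
  using ring_hom_trans[OF K.indexed_const_hom class_J_hom[unfolded ring_R_def]]
  by (simp add: const_J_def[abs_def] comp_def)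

lemma c_R_mem: "1 \<le> i \<Longrightarrow> i \<le> n \<Longrightarrow> c\<^sub>R i \<in> carrier (R_mod_J K n)"
  using class_J_hom var_R_mem by (auto simp: ring_hom_def)

lemma R_mod_J_hom_eqI:
  assumes A: "ring A" and f: "f \<in> ring_hom (R_mod_J K n) A" and g: "g \<in> ring_hom (R_mod_J K n) A"
    and const: "\<And>k. k \<in> carrier K \<Longrightarrow> f (const_J K n k) = g (const_J K n k)"
    and var: "\<And>i. 1 \<le> i \<Longrightarrow> i \<le> n \<Longrightarrow> f (c\<^sub>R i) = g (c\<^sub>R i)"
    and x: "x \<in> carrier (R_mod_J K n)"
  shows "f x = g x"
proof -
  obtain p where p: "p \<in> carrier (ring_R K n)" "x = class_J K n p"
    using x by (auto simp: R_mod_J_def carrier_Quot class_J_def)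
  have "(f \<circ> class_J K n) p = (g \<circ> class_J K n) p"
  proof (rule K.poly_ring_hom_eqI[OF A, of _ "{1..n}", folded ring_R_def])
    show "f \<circ> class_J K n \<in> ring_hom (ring_R K n) A" by (rule ring_hom_trans[OF class_J_hom f])
    show "g \<circ> class_J K n \<in> ring_hom (ring_R K n) A" by (rule ring_hom_trans[OF class_J_hom g])
  qed (use p const var in \<open>auto simp: const_J_def\<close>)
  then show ?thesis using p by simp
qed

text \<open>Existence half of the universal property: R/J carries the generic solution of the matrix
  equation, so every solution in a commutative K-algebra comes from a homomorphism.\<close>

lemma R_mod_J_lift:
  assumes A: "cring A" and \<alpha>: "\<alpha> \<in> ring_hom K A"
    and c: "\<And>i. 1 \<le> i \<Longrightarrow> i \<le> n \<Longrightarrow> c i \<in> carrier A"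
    and eta: "eta_prod A c 1 n = Mat2 (\<ominus>\<^bsub>A\<^esub> \<one>\<^bsub>A\<^esub>) \<zero>\<^bsub>A\<^esub> \<zero>\<^bsub>A\<^esub> (\<ominus>\<^bsub>A\<^esub> \<one>\<^bsub>A\<^esub>)"
  obtains h where "h \<in> ring_hom (R_mod_J K n) A"
    "\<And>k. k \<in> carrier K \<Longrightarrow> h (const_J K n k) = \<alpha> k"
    "\<And>i. 1 \<le> i \<Longrightarrow> i \<le> n \<Longrightarrow> h (c\<^sub>R i) = c i"
proof -
  interpret A: cring A by fact
  \<comment> \<open>\<open>poly_ring_eval\<close> expects a value for every index of the type. The
    padding by zero is invisible, since only the indices 1 to n occur in R.\<close>
  define c' where "c' i = (if 1 \<le> i \<and> i \<le> n then c i else \<zero>\<^bsub>A\<^esub>)" for i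
  have c': "c' i \<in> carrier A" for i using c by (simp add: c'_def)
  define f where "f = poly_ring_eval K A \<alpha> c'"
  have f: "f \<in> ring_hom (ring_R K n) A" "\<And>k. k \<in> carrier K \<Longrightarrow> f (K.indexed_const k) = \<alpha> k"
    "\<And>i. f (K.indexed_var i) = c' i"
    unfolding f_def ring_R_def
    by (rule poly_ring_eval_hom[OF K.is_cring A \<alpha> c'], rule poly_ring_eval_const[OF K.is_cring A \<alpha> c'],
        assumption, rule poly_ring_eval_var[OF K.is_cring A \<alpha> c'])
  interpret f: ring_hom_cring "ring_R K n" A f by (rule ring_hom_cringI_mem[OF R.is_cring A f(1)])
  have "mat2_map f (eta_prod (ring_R K n) K.indexed_var 1 n) = eta_prod A (\<lambda>j. f (K.indexed_var j)) 1 n"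
    by (rule A.eta_prod_hom[OF f.ring_hom_cring_axioms]) (auto intro: var_R_mem)
  also have "\<dots> = eta_prod A c 1 n"
    by (rule A.eta_prod_cong) (simp add: f c'_def)
  finally have fe: "mat2_map f (eta_prod (ring_R K n) K.indexed_var 1 n) =
      Mat2 (\<ominus>\<^bsub>A\<^esub> \<one>\<^bsub>A\<^esub>) \<zero>\<^bsub>A\<^esub> \<zero>\<^bsub>A\<^esub> (\<ominus>\<^bsub>A\<^esub> \<one>\<^bsub>A\<^esub>)"
    unfolding eta .
  \<comment> \<open>\<open>f\<close> carries the eta product to -id, hence the entries of
    \<open>M_J\<close> to those of -id + id.\<close>
  have "f x = \<zero>\<^bsub>A\<^esub>" if "x \<in> {e11 M_J, e12 M_J, e21 M_J, e22 M_J}" for x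
    using that fe R.eta_prod_closed[of 1 n "K.indexed_var"] var_R_mem
    by (auto simp: M_J_def mat2_add_def mat2_one_def mat2_map_def A.l_neg)
  then have "f x = \<zero>\<^bsub>A\<^esub>" if "x \<in> ideal_J K n" for x
    using ring_hom_genideal_zero[OF R.ring_axioms A.ring_axioms f(1) M_J_mem] that
    unfolding ideal_J_eq by blast
  then obtain h where "h \<in> ring_hom (ring_R K n Quot ideal_J K n) A"
    "\<And>x. x \<in> carrier (ring_R K n) \<Longrightarrow> h (ideal_J K n +>\<^bsub>ring_R K n\<^esub> x) = f x"
    using J.Quot_lift[OF A.ring_axioms f(1)] by metis
  then show thesis
    by (intro that[of h]) (auto simp: R_mod_J_def const_J_def class_J_def const_R_mem var_R_mem f c'_def)
qed

section \<open>The quotient G(2,n) and its universal property\<close>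

text \<open>The three wrapped pairs are the only ones with an index beyond n that occur in the
  relations P_{i,i+1} = 1 or among the images P_{i,i+2} of the generators. With n \<ge> 3 the
  reduced indices appear in increasing order.\<close>

lemma plu_var_eq:
  "1 \<le> i \<Longrightarrow> i < j \<Longrightarrow> j \<le> n \<Longrightarrow> plu_var K n i j = K.indexed_var (i, j)"
  "plu_var K n n (n + 1) = K.indexed_var (1, n)"
  "plu_var K n n (n + 2) = K.indexed_var (2, n)"
  "plu_var K n (n - 1) (n + 1) = K.indexed_var (1, n - 1)"
  using n red_index_id[of i n] red_index_id[of j n] red_index_id[of n n] red_index_id[of "n - 1" n]
    red_index_add[of 1 n] red_index_add[of 2 n]
  by (auto simp: plu_var_def)

lemma plu_var_mem: "1 \<le> i \<Longrightarrow> i < j \<Longrightarrow> j \<le> n \<Longrightarrow> plu_var K n i j \<in> carrier (plu_ring K n)"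
  unfolding plu_var_eq plu_ring_def by (rule K.indexed_var_mem) (auto simp: plu_index_def)

lemma plu_var_succ_mem: "1 \<le> i \<Longrightarrow> i \<le> n \<Longrightarrow> plu_var K n i (i + 1) \<in> carrier (plu_ring K n)"
  using plu_var_mem[of i "i + 1"] plu_var_mem[of 1 n] plu_var_eq(1)[of 1 n] plu_var_eq(2) n
  by (cases "i = n") auto

definition "plu_rel i j k l =
  plu_var K n i k \<otimes>\<^bsub>plu_ring K n\<^esub> plu_var K n j l \<ominus>\<^bsub>plu_ring K n\<^esub>
   (plu_var K n i j \<otimes>\<^bsub>plu_ring K n\<^esub> plu_var K n k l \<oplus>\<^bsub>plu_ring K n\<^esub>
    plu_var K n i l \<otimes>\<^bsub>plu_ring K n\<^esub> plu_var K n j k)"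

definition "plu_rels = {plu_rel i j k l | i j k l. 1 \<le> i \<and> i < j \<and> j < k \<and> k < l \<and> l \<le> n}"

lemma plu_rels_mem: "plu_rels \<subseteq> carrier (plu_ring K n)"
  unfolding plu_rels_def plu_rel_def by (auto intro!: P.minus_closed P.add.m_closed P.m_closed plu_var_mem)

lemma plu_ideal_eq: "plu_ideal K n = Idl\<^bsub>plu_ring K n\<^esub> plu_rels"
  unfolding plu_ideal_def plu_rels_def plu_rel_def by simp

sublocale I: ideal "plu_ideal K n" "plu_ring K n"
  unfolding plu_ideal_eq by (rule P.genideal_ideal[OF plu_rels_mem])

sublocale O: cring "O_Gr K n"
  unfolding O_Gr_def by (rule I.quotient_is_cring[OF P.is_cring])

definition "proj_O = (+>\<^bsub>plu_ring K n\<^esub>) (plu_ideal K n)"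

lemma proj_O_hom: "proj_O \<in> ring_hom (plu_ring K n) (O_Gr K n)"
  using I.rcos_ring_hom by (simp add: proj_O_def O_Gr_def)

definition "frieze_rels = {P_Gr K n i (i + 1) \<ominus>\<^bsub>O_Gr K n\<^esub> \<one>\<^bsub>O_Gr K n\<^esub> | i. 1 \<le> i \<and> i \<le> n}"

lemma frieze_rels_mem: "frieze_rels \<subseteq> carrier (O_Gr K n)"
  using ring_hom_closed[OF proj_O_hom] plu_var_succ_mem
  by (auto simp: frieze_rels_def P_Gr_def proj_O_def intro!: O.minus_closed)

lemma frieze_ideal_eq: "frieze_ideal K n = Idl\<^bsub>O_Gr K n\<^esub> frieze_rels"
  unfolding frieze_ideal_def frieze_rels_def by simp

sublocale F: ideal "frieze_ideal K n" "O_Gr K n"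
  unfolding frieze_ideal_eq by (rule O.genideal_ideal[OF frieze_rels_mem])

sublocale G: cring "G_ring K n"
  unfolding G_ring_def by (rule F.quotient_is_cring[OF O.is_cring])

lemma zero_G: "\<zero>\<^bsub>G_ring K n\<^esub> = frieze_ideal K n"
  by (simp add: G_ring_def FactRing_def)

lemma F_hom: "(+>\<^bsub>O_Gr K n\<^esub>) (frieze_ideal K n) \<in> ring_hom (O_Gr K n) (G_ring K n)"
  using F.rcos_ring_hom by (simp add: G_ring_def)

lemma proj_G_hom: "proj_G \<in> ring_hom (plu_ring K n) (G_ring K n)"
proof -
  have "proj_G = (+>\<^bsub>O_Gr K n\<^esub>) (frieze_ideal K n) \<circ> proj_O"
    by (auto simp: proj_G_def proj_O_def)
  then show ?thesis using ring_hom_trans[OF proj_O_hom F_hom] by simp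
qed

lemma P_G_eq: "P_G K n i j = proj_G (plu_var K n i j)"
  by (simp add: P_G_def P_Gr_def proj_G_def)

lemma const_G_eq: "const_G K n k = proj_G (K.indexed_const k)"
  by (simp add: const_G_def const_Gr_def proj_G_def)

lemma const_G_hom: "const_G K n \<in> ring_hom K (G_ring K n)"
proof -
  have "const_G K n = proj_G \<circ> K.indexed_const" by (auto simp: const_G_eq)
  then show ?thesis
    using ring_hom_trans[OF K.indexed_const_hom proj_G_hom[unfolded plu_ring_def]] by simp
qed

lemma P_G_mem: "1 \<le> i \<Longrightarrow> i < j \<Longrightarrow> j \<le> n \<Longrightarrow> P_G K n i j \<in> carrier (G_ring K n)"
  unfolding P_G_eq by (rule ring_hom_closed[OF proj_G_hom plu_var_mem])

lemma P_G_wrap: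
  "P_G K n n (n + 1) = P_G K n 1 n" "P_G K n n (n + 2) = P_G K n 2 n"
  "P_G K n (n - 1) (n + 1) = P_G K n 1 (n - 1)"
  using n plu_var_eq by (simp_all add: P_G_eq)

lemma P_G_plucker:
  assumes "1 \<le> i" "i < j" "j < k" "k < l" "l \<le> n"
  shows "P_G K n i k \<otimes>\<^bsub>G_ring K n\<^esub> P_G K n j l =
    P_G K n i j \<otimes>\<^bsub>G_ring K n\<^esub> P_G K n k l \<oplus>\<^bsub>G_ring K n\<^esub> P_G K n i l \<otimes>\<^bsub>G_ring K n\<^esub> P_G K n j k"
proof -
  interpret h: ring_hom_cring "plu_ring K n" "G_ring K n" proj_G
    by (rule ring_hom_cringI_mem[OF P.is_cring G.is_cring proj_G_hom])
  have "plu_rel i j k l \<in> plu_ideal K n"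
    using P.genideal_self[OF plu_rels_mem] assms unfolding plu_ideal_eq plu_rels_def by blast
  then have "proj_O (plu_rel i j k l) = \<zero>\<^bsub>O_Gr K n\<^esub>"
    by (simp add: proj_O_def O_Gr_def FactRing_def I.a_rcos_const)
  then have "proj_G (plu_rel i j k l) = frieze_ideal K n +>\<^bsub>O_Gr K n\<^esub> \<zero>\<^bsub>O_Gr K n\<^esub>"
    by (simp add: proj_G_def proj_O_def)
  also have "\<dots> = \<zero>\<^bsub>G_ring K n\<^esub>"
    by (simp add: G_ring_def FactRing_def F.a_rcos_const)
  \<comment> \<open>The difference is unfolded in the polynomial ring so that \<open>proj_G\<close>
    passes through it, and folded again in the target, where a zero difference means
    equality.\<close>
  finally show ?thesis
    using assms P_G_mem plu_var_mem
    by (simp add: P_G_eq[symmetric] plu_rel_def a_minus_def[of "plu_ring K n"]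
        G.r_right_minus_eq flip: a_minus_def[of "G_ring K n"])
qed

lemma P_G_succ:
  assumes "1 \<le> i" "i \<le> n"
  shows "P_G K n i (i + 1) = \<one>\<^bsub>G_ring K n\<^esub>"
proof -
  interpret h: ring_hom_cring "O_Gr K n" "G_ring K n" "(+>\<^bsub>O_Gr K n\<^esub>) (frieze_ideal K n)"
    by (rule ring_hom_cringI_mem[OF O.is_cring G.is_cring F_hom])
  have m: "P_Gr K n i (i + 1) \<in> carrier (O_Gr K n)"
    using ring_hom_closed[OF proj_O_hom plu_var_succ_mem] assms by (simp add: P_Gr_def proj_O_def)
  have "P_Gr K n i (i + 1) \<ominus>\<^bsub>O_Gr K n\<^esub> \<one>\<^bsub>O_Gr K n\<^esub> \<in> frieze_ideal K n"
    using O.genideal_self[OF frieze_rels_mem] assms unfolding frieze_ideal_eq frieze_rels_def by blast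
  then have "frieze_ideal K n +>\<^bsub>O_Gr K n\<^esub> (P_Gr K n i (i + 1) \<ominus>\<^bsub>O_Gr K n\<^esub> \<one>\<^bsub>O_Gr K n\<^esub>) = \<zero>\<^bsub>G_ring K n\<^esub>"
    unfolding zero_G by (rule F.a_rcos_const)
  then show ?thesis
    using m by (simp add: P_G_def a_minus_def[of "O_Gr K n"] G.r_right_minus_eq
        flip: a_minus_def[of "G_ring K n"])
qed

lemma G_hom_eqI:
  assumes A: "ring A" and f: "f \<in> ring_hom (G_ring K n) A" and g: "g \<in> ring_hom (G_ring K n) A"
    and const: "\<And>k. k \<in> carrier K \<Longrightarrow> f (const_G K n k) = g (const_G K n k)"
    and var: "\<And>i j. 1 \<le> i \<Longrightarrow> i < j \<Longrightarrow> j \<le> n \<Longrightarrow> f (P_G K n i j) = g (P_G K n i j)"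
    and x: "x \<in> carrier (G_ring K n)"
  shows "f x = g x"
proof -
  obtain p where p: "p \<in> carrier (plu_ring K n)" "x = proj_G p"
    using x by (auto simp: G_ring_def O_Gr_def carrier_Quot proj_G_def)
  have "(f \<circ> proj_G) p = (g \<circ> proj_G) p"
  proof (rule K.poly_ring_hom_eqI[OF A, of _ "plu_index n"])
    show "f \<circ> proj_G \<in> ring_hom (poly_ring K (plu_index n)) A"
      "g \<circ> proj_G \<in> ring_hom (poly_ring K (plu_index n)) A"
      using f g ring_hom_trans[OF proj_G_hom] by (auto simp: plu_ring_def)
  next
    fix ij assume "ij \<in> plu_index n"
    then obtain i j where "ij = (i, j)" "1 \<le> i" "i < j" "j \<le> n" by (auto simp: plu_index_def)
    then show "(f \<circ> proj_G) (K.indexed_var ij) = (g \<circ> proj_G) (K.indexed_var ij)"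
      using var[of i j] by (simp add: P_G_eq plu_var_eq)
  qed (use p const in \<open>auto simp: const_G_eq plu_ring_def\<close>)
  then show ?thesis using p by simp
qed

text \<open>The evaluation homomorphism descends twice, through the Pluecker ideal and then through
  the frieze ideal.\<close>

lemma G_lift:
  assumes A: "cring A" and \<alpha>: "\<alpha> \<in> ring_hom K A"
    and q: "\<And>i j. 1 \<le> i \<Longrightarrow> i < j \<Longrightarrow> j \<le> n \<Longrightarrow> q i j \<in> carrier A"
    and plucker: "\<And>i j k l. 1 \<le> i \<Longrightarrow> i < j \<Longrightarrow> j < k \<Longrightarrow> k < l \<Longrightarrow> l \<le> n \<Longrightarrow>
      q i k \<otimes>\<^bsub>A\<^esub> q j l = q i j \<otimes>\<^bsub>A\<^esub> q k l \<oplus>\<^bsub>A\<^esub> q i l \<otimes>\<^bsub>A\<^esub> q j k"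
    and one: "\<And>i. 1 \<le> i \<Longrightarrow> i + 1 \<le> n \<Longrightarrow> q i (i + 1) = \<one>\<^bsub>A\<^esub>" "q 1 n = \<one>\<^bsub>A\<^esub>"
  obtains h where "h \<in> ring_hom (G_ring K n) A"
    "\<And>k. k \<in> carrier K \<Longrightarrow> h (const_G K n k) = \<alpha> k"
    "\<And>i j. 1 \<le> i \<Longrightarrow> i < j \<Longrightarrow> j \<le> n \<Longrightarrow> h (P_G K n i j) = q i j"
proof -
  interpret A: cring A by fact
  \<comment> \<open>Indeterminates are indexed by pairs, and evaluation needs a value at every pair;
    pairs outside the index set get zero.\<close>
  define q' where "q' = (\<lambda>(i, j). if 1 \<le> i \<and> i < j \<and> j \<le> n then q i j else \<zero>\<^bsub>A\<^esub>)"
  have q': "q' ij \<in> carrier A" for ij using q by (simp add: q'_def split: prod.split)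
  define f where "f = poly_ring_eval K A \<alpha> q'"
  have f: "f \<in> ring_hom (plu_ring K n) A" "\<And>k. k \<in> carrier K \<Longrightarrow> f (K.indexed_const k) = \<alpha> k"
    "\<And>i. f (K.indexed_var i) = q' i"
    unfolding f_def plu_ring_def
    by (rule poly_ring_eval_hom[OF K.is_cring A \<alpha> q'], rule poly_ring_eval_const[OF K.is_cring A \<alpha> q'],
        assumption, rule poly_ring_eval_var[OF K.is_cring A \<alpha> q'])
  interpret f: ring_hom_cring "plu_ring K n" A f by (rule ring_hom_cringI_mem[OF P.is_cring A f(1)])
  have fv: "f (plu_var K n i j) = q i j" if "1 \<le> i" "i < j" "j \<le> n" for i j
    using that by (simp add: plu_var_eq f q'_def)
  have "f x = \<zero>\<^bsub>A\<^esub>" if x_in: "x \<in> plu_rels" for x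
  proof -
    obtain i j k l where x: "x = plu_rel i j k l" "1 \<le> i" "i < j" "j < k" "k < l" "l \<le> n"
      using x_in unfolding plu_rels_def by blast
    then have "f x = q i k \<otimes>\<^bsub>A\<^esub> q j l \<ominus>\<^bsub>A\<^esub> (q i j \<otimes>\<^bsub>A\<^esub> q k l \<oplus>\<^bsub>A\<^esub> q i l \<otimes>\<^bsub>A\<^esub> q j k)"
      by (simp add: plu_rel_def a_minus_def plu_var_mem fv)
    then show ?thesis using plucker[OF x(2-6)] q x(2-6) by (simp add: A.r_right_minus_eq)
  qed
  then have "f x = \<zero>\<^bsub>A\<^esub>" if "x \<in> plu_ideal K n" for x
    using ring_hom_genideal_zero[OF P.ring_axioms A.ring_axioms f(1) plu_rels_mem] that
    unfolding plu_ideal_eq by blast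
  then obtain g where g: "g \<in> ring_hom (O_Gr K n) A"
    "\<And>x. x \<in> carrier (plu_ring K n) \<Longrightarrow> g (plu_ideal K n +>\<^bsub>plu_ring K n\<^esub> x) = f x"
    using I.Quot_lift[OF A.ring_axioms f(1)] unfolding O_Gr_def by metis
  interpret g: ring_hom_cring "O_Gr K n" A g by (rule ring_hom_cringI_mem[OF O.is_cring A g(1)])
  have "g x = \<zero>\<^bsub>A\<^esub>" if x_in: "x \<in> frieze_rels" for x
  proof -
    obtain i where i: "x = P_Gr K n i (i + 1) \<ominus>\<^bsub>O_Gr K n\<^esub> \<one>\<^bsub>O_Gr K n\<^esub>" "1 \<le> i" "i \<le> n"
      using x_in by (auto simp: frieze_rels_def)
    have "P_Gr K n i (i + 1) \<in> carrier (O_Gr K n)"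
      using ring_hom_closed[OF proj_O_hom plu_var_succ_mem] i by (simp add: P_Gr_def proj_O_def)
    moreover have "g (P_Gr K n i (i + 1)) = \<one>\<^bsub>A\<^esub>"
    \<comment> \<open>For \<open>i = n\<close> the generator is the wrapped P_{n,n+1} = P_{1,n}, so
      the separate assumption on \<open>q 1 n\<close> is used.\<close>
    proof (cases "i = n")
      case True
      then show ?thesis
        using g(2)[OF plu_var_succ_mem[of n]] n fv[of 1 n] one(2) plu_var_eq(1)[of 1 n] plu_var_eq(2)
        by (simp add: P_Gr_def)
    next
      case False
      then show ?thesis
        using g(2)[OF plu_var_succ_mem[of i]] i fv[of i "i + 1"] one(1)[of i] by (simp add: P_Gr_def)
    qed
    ultimately show ?thesis using i by (simp add: a_minus_def A.r_neg)
  qed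
  then have "g x = \<zero>\<^bsub>A\<^esub>" if "x \<in> frieze_ideal K n" for x
    using ring_hom_genideal_zero[OF O.ring_axioms A.ring_axioms g(1) frieze_rels_mem] that
    unfolding frieze_ideal_eq by blast
  then obtain h where h: "h \<in> ring_hom (G_ring K n) A"
    "\<And>x. x \<in> carrier (O_Gr K n) \<Longrightarrow> h (frieze_ideal K n +>\<^bsub>O_Gr K n\<^esub> x) = g x"
    using F.Quot_lift[OF A.ring_axioms g(1)] unfolding G_ring_def by metis
  have hp: "h (proj_G x) = f x" if "x \<in> carrier (plu_ring K n)" for x
    using h(2)[OF ring_hom_closed[OF proj_O_hom that]] g(2)[OF that] by (simp add: proj_G_def proj_O_def)
  show thesis
  proof (rule that[of h])
    fix k assume "k \<in> carrier K"
    then show "h (const_G K n k) = \<alpha> k"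
      using hp[OF K.indexed_const_mem[of k "plu_index n", folded plu_ring_def]] f(2)
      by (simp add: const_G_eq)
  qed (use h hp plu_var_mem fv in \<open>auto simp: P_G_eq\<close>)
qed

end

text \<open>\<open>inv_into\<close> will be known to agree with a constructed homomorphism only on
  the carrier; this suffices, since being an algebra homomorphism depends on the values
  there.\<close>

lemma alg_hom_cong:
  assumes A: "ring A" and \<alpha>: "\<And>k. k \<in> carrier K \<Longrightarrow> \<alpha> k \<in> carrier A"
    and f: "f \<in> alg_hom K A \<alpha> B \<beta>" and g: "\<And>x. x \<in> carrier A \<Longrightarrow> g x = f x"
  shows "g \<in> alg_hom K A \<alpha> B \<beta>"
proof -
  interpret A: ring A by fact
  show ?thesis using assms by (auto simp: alg_hom_def ring_hom_def)
qed

section \<open>The homomorphisms in both directions and their values on generators\<close>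

context frieze_ring
begin

abbreviation "c\<^sub>G i \<equiv> P_G K n i (i + 2)"

lemma eta_prod_c_R:
  assumes "1 \<le> i" "i + m \<le> n + 1"
  shows "eta_prod (R_mod_J K n) (\<lambda>i. c\<^sub>R i) i m =
    mat2_map (class_J K n) (eta_prod (ring_R K n) K.indexed_var i m)"
  by (rule Q.eta_prod_hom[symmetric, OF ring_hom_cringI_mem[OF R.is_cring Q.is_cring class_J_hom]])
     (use assms var_R_mem in auto)

text \<open>The product has \<open>j - 1 - i\<close> factors, with entries c_i, ..., c_{j-2}; the
  shifted length convention turns this into length \<open>j - i\<close>.\<close>

lemma class_J_e11:
  assumes "1 \<le> i" "i < j" "j \<le> n"
  shows "class_J K n (e11 (eta_prod (ring_R K n) K.indexed_var i (j - 1 - i))) =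
    continuant (R_mod_J K n) (\<lambda>i. c\<^sub>R i) i (j - i)"
proof -
  have "e11 (eta_prod (R_mod_J K n) (\<lambda>i. c\<^sub>R i) i (j - 1 - i)) =
      continuant (R_mod_J K n) (\<lambda>i. c\<^sub>R i) i (Suc (j - 1 - i))"
    by (rule Q.e11_eta_prod) (use assms c_R_mem in auto)
  moreover have "Suc (j - 1 - i) = j - i" using assms by simp
  ultimately show ?thesis using assms by (simp add: eta_prod_c_R mat2_map_def)
qed

lemma continuant_c_R:
  "continuant (R_mod_J K n) (\<lambda>i. c\<^sub>R i) 1 (n - 1) = \<one>\<^bsub>R_mod_J K n\<^esub>"
  "continuant (R_mod_J K n) (\<lambda>i. c\<^sub>R i) 1 (n - 2) = c\<^sub>R (n - 1)"
  "continuant (R_mod_J K n) (\<lambda>i. c\<^sub>R i) 2 (n - 2) = c\<^sub>R n"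
proof -
  interpret h: ring_hom_cring "ring_R K n" "R_mod_J K n" "class_J K n"
    by (rule ring_hom_cringI_mem[OF R.is_cring Q.is_cring class_J_hom])
  define M where "M = mat2_add (R_mod_J K n) (eta_prod (R_mod_J K n) (\<lambda>i. c\<^sub>R i) 1 n) (mat2_one (R_mod_J K n))"
  have "M = mat2_map (class_J K n) M_J"
    unfolding M_def M_J_def
    using eta_prod_c_R[of 1 n] R.eta_prod_closed[of 1 n K.indexed_var] var_R_mem
    by (auto simp: mat2_add_def mat2_one_def mat2_map_def)
  moreover have "class_J K n x = \<zero>\<^bsub>R_mod_J K n\<^esub>" if "x \<in> {e11 M_J, e12 M_J, e21 M_J, e22 M_J}" for x
    using R.genideal_self[OF M_J_mem] that class_J_zero unfolding ideal_J_eq by blast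
  ultimately have "e11 M = \<zero>\<^bsub>R_mod_J K n\<^esub>" "e12 M = \<zero>\<^bsub>R_mod_J K n\<^esub>"
    "e21 M = \<zero>\<^bsub>R_mod_J K n\<^esub>" "e22 M = \<zero>\<^bsub>R_mod_J K n\<^esub>"
    by (simp_all add: mat2_map_def)
  then show "continuant (R_mod_J K n) (\<lambda>i. c\<^sub>R i) 1 (n - 1) = \<one>\<^bsub>R_mod_J K n\<^esub>"
    "continuant (R_mod_J K n) (\<lambda>i. c\<^sub>R i) 1 (n - 2) = c\<^sub>R (n - 1)"
    "continuant (R_mod_J K n) (\<lambda>i. c\<^sub>R i) 2 (n - 2) = c\<^sub>R n"
    using Q.continuant_of_eta_prod_eq_minus_one[OF n c_R_mem M_def] by blast+
qed

lemma exists_psi: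
  obtains \<psi> where "\<psi> \<in> alg_hom K (G_ring K n) (const_G K n) (R_mod_J K n) (const_J K n)"
    "\<And>i j. 1 \<le> i \<Longrightarrow> i < j \<Longrightarrow> j \<le> n \<Longrightarrow> \<psi> (P_G K n i j) = continuant (R_mod_J K n) (\<lambda>i. c\<^sub>R i) i (j - i)"
proof -
  let ?q = "\<lambda>i j. continuant (R_mod_J K n) (\<lambda>i. c\<^sub>R i) i (j - i)"
  obtain h where "h \<in> ring_hom (G_ring K n) (R_mod_J K n)"
    "\<And>k. k \<in> carrier K \<Longrightarrow> h (const_G K n k) = const_J K n k"
    "\<And>i j. 1 \<le> i \<Longrightarrow> i < j \<Longrightarrow> j \<le> n \<Longrightarrow> h (P_G K n i j) = ?q i j"
  proof (rule G_lift[OF Q.is_cring const_J_hom, of ?q])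
    fix i j assume "1 \<le> i" "i < j" "j \<le> n"
    then show "?q i j \<in> carrier (R_mod_J K n)" by (intro Q.continuant_closed c_R_mem) auto
  next
    fix i j k l assume *: "1 \<le> i" "i < j" "j < k" "k < l" "l \<le> n"
    \<comment> \<open>Euler's identity with the gaps between consecutive indices as lengths; the
      ordering of the indices makes all truncated differences add up.\<close>
    have "continuant (R_mod_J K n) (\<lambda>i. c\<^sub>R i) i ((j - i) + (k - j)) \<otimes>\<^bsub>R_mod_J K n\<^esub>
        continuant (R_mod_J K n) (\<lambda>i. c\<^sub>R i) (i + (j - i)) ((k - j) + (l - k)) =
        ?q i j \<otimes>\<^bsub>R_mod_J K n\<^esub> continuant (R_mod_J K n) (\<lambda>i. c\<^sub>R i) (i + (j - i) + (k - j)) (l - k) \<oplus>\<^bsub>R_mod_J K n\<^esub>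
        continuant (R_mod_J K n) (\<lambda>i. c\<^sub>R i) i ((j - i) + (k - j) + (l - k)) \<otimes>\<^bsub>R_mod_J K n\<^esub>
        continuant (R_mod_J K n) (\<lambda>i. c\<^sub>R i) (i + (j - i)) (k - j)"
      by (rule Q.continuant_euler) (use * c_R_mem in auto)
    then show "?q i k \<otimes>\<^bsub>R_mod_J K n\<^esub> ?q j l =
        ?q i j \<otimes>\<^bsub>R_mod_J K n\<^esub> ?q k l \<oplus>\<^bsub>R_mod_J K n\<^esub> ?q i l \<otimes>\<^bsub>R_mod_J K n\<^esub> ?q j k"
      using * by simp
  next
    \<comment> \<open>Among the relations of G(2,n), this is the one whose image depends on the
      matrix equation; the others hold for continuants in general. The other two values in
      \<open>continuant_c_R\<close> serve to identify the images of c_{n-1} and c_n.\<close>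
    show "?q 1 n = \<one>\<^bsub>R_mod_J K n\<^esub>" by (rule continuant_c_R)
  qed auto
  then show thesis by (intro that[of h]) (auto simp: alg_hom_def)
qed

lemma exists_phi:
  obtains \<phi> where "\<phi> \<in> alg_hom K (R_mod_J K n) (const_J K n) (G_ring K n) (const_G K n)"
    "\<And>i. 1 \<le> i \<Longrightarrow> i \<le> n \<Longrightarrow> \<phi> (c\<^sub>R i) = c\<^sub>G i"
proof -
  have eta: "eta_prod (G_ring K n) (\<lambda>i. c\<^sub>G i) 1 n =
      Mat2 (\<ominus>\<^bsub>G_ring K n\<^esub> \<one>\<^bsub>G_ring K n\<^esub>) \<zero>\<^bsub>G_ring K n\<^esub> \<zero>\<^bsub>G_ring K n\<^esub> (\<ominus>\<^bsub>G_ring K n\<^esub> \<one>\<^bsub>G_ring K n\<^esub>)"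
  proof (rule G.eta_prod_plucker[OF n, where p = "P_G K n"])
    show "P_G K n 1 n = \<one>\<^bsub>G_ring K n\<^esub>" using P_G_succ[of n] P_G_wrap n by simp
    \<comment> \<open>Here \<open>n - 1 + 2\<close> has to become \<open>n + 1\<close> before the
      wrapping rule for c_{n-1} applies.\<close>
    show "P_G K n (n - 1) (n - 1 + 2) = P_G K n 1 (n - 1)" using P_G_wrap n by simp
  qed (use P_G_mem P_G_plucker P_G_succ P_G_wrap in auto)
  have "c\<^sub>G i \<in> carrier (G_ring K n)" if i: "1 \<le> i" "i \<le> n" for i
  proof -
    have "i + 2 \<le> n \<or> i = n - 1 \<or> i = n" using i by arith
    then show ?thesis
      using P_G_mem[of i "i + 2"] P_G_mem[of 1 "n - 1"] P_G_mem[of 2 n] P_G_wrap n i by auto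
  qed
  from R_mod_J_lift[OF G.is_cring const_G_hom this eta]
  obtain h where "h \<in> ring_hom (R_mod_J K n) (G_ring K n)"
    "\<And>k. k \<in> carrier K \<Longrightarrow> h (const_J K n k) = const_G K n k"
    "\<And>i. 1 \<le> i \<Longrightarrow> i \<le> n \<Longrightarrow> h (c\<^sub>R i) = c\<^sub>G i"
    by blast
  then show thesis by (intro that[of h]) (auto simp: alg_hom_def)
qed

text \<open>A homomorphism carries continuants to continuants, and those in the P_{i,i+2} are again
  Pluecker coordinates. This is the identity \<phi> \<psi> = id on the generators P_{i,j}.\<close>

lemma phi_continuant:
  assumes \<phi>: "\<phi> \<in> ring_hom (R_mod_J K n) (G_ring K n)" "\<And>i. 1 \<le> i \<Longrightarrow> i \<le> n \<Longrightarrow> \<phi> (c\<^sub>R i) = c\<^sub>G i"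
    and ij: "1 \<le> i" "i < j" "j \<le> n"
  shows "\<phi> (continuant (R_mod_J K n) (\<lambda>i. c\<^sub>R i) i (j - i)) = P_G K n i j"
proof -
  have "\<phi> (continuant (R_mod_J K n) (\<lambda>i. c\<^sub>R i) i (j - i)) = continuant (G_ring K n) (\<lambda>i. \<phi> (c\<^sub>R i)) i (j - i)"
    by (rule G.continuant_hom[OF ring_hom_cringI_mem[OF Q.is_cring G.is_cring \<phi>(1)]]) (use ij c_R_mem in auto)
  also have "\<dots> = P_G K n i (i + (j - i))"
    by (rule G.continuant_plucker[where n = n])
       (use P_G_mem P_G_plucker P_G_succ \<phi>(2) ij in auto)
  finally show ?thesis using ij by simp
qed

text \<open>The identity \<psi> \<phi> = id on generators. For i \<le> n-2 the continuant of length
  2 is c_i by definition; for the two wrapped generators the value comes from the matrix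
  equation.\<close>

lemma psi_c_G:
  assumes "\<And>i j. 1 \<le> i \<Longrightarrow> i < j \<Longrightarrow> j \<le> n \<Longrightarrow>
      \<psi> (P_G K n i j) = continuant (R_mod_J K n) (\<lambda>i. c\<^sub>R i) i (j - i)"
    and i: "1 \<le> i" "i \<le> n"
  shows "\<psi> (c\<^sub>G i) = c\<^sub>R i"
proof -
  consider "i + 2 \<le> n" | "i = n - 1" | "i = n" using i by linarith
  then show ?thesis
  proof cases
    case 1
    then have "\<psi> (c\<^sub>G i) = continuant (R_mod_J K n) (\<lambda>i. c\<^sub>R i) i (Suc (Suc 0))"
      using assms(1)[of i "i + 2"] i by (simp add: numeral_2_eq_2)
    then show ?thesis using c_R_mem[OF i] by (simp add: a_minus_def)
  next
    case 2
    then have "c\<^sub>G i = P_G K n 1 (n - 1)" using P_G_wrap n by simp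
    then show ?thesis using assms(1)[of 1 "n - 1"] 2 continuant_c_R n by (simp add: numeral_2_eq_2)
  next
    case 3
    then show ?thesis using assms(1)[of 2 n] continuant_c_R n P_G_wrap by simp
  qed
qed

end

theorem theorem4p3:
  fixes K :: "('k, 'b) ring_scheme" and n :: nat
  assumes "cring K" and "n \<ge> 3"
  shows "\<exists>\<phi>.
    \<phi> \<in> alg_iso K (R_mod_J K n) (const_J K n) (G_ring K n) (const_G K n) \<and>
    (\<forall>i\<in>{1..n}. \<phi> (class_J K n (ring.indexed_var K i)) = P_G K n i (i + 2)) \<and>
    (\<forall>\<phi>'\<in>alg_iso K (R_mod_J K n) (const_J K n) (G_ring K n) (const_G K n).
       (\<forall>i\<in>{1..n}. \<phi>' (class_J K n (ring.indexed_var K i)) = P_G K n i (i + 2)) \<longrightarrow>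
       (\<forall>x\<in>carrier (R_mod_J K n). \<phi>' x = \<phi> x)) \<and>
    inv_into (carrier (R_mod_J K n)) \<phi>
      \<in> alg_hom K (G_ring K n) (const_G K n) (R_mod_J K n) (const_J K n) \<and>
    (\<forall>i j. 1 \<le> i \<and> i < j \<and> j \<le> n \<longrightarrow>
       inv_into (carrier (R_mod_J K n)) \<phi> (P_G K n i j) =
         class_J K n (e11 (eta_prod (ring_R K n) (ring.indexed_var K) i (j - 1 - i)))) \<and>
    (\<forall>\<psi>\<in>alg_hom K (G_ring K n) (const_G K n) (R_mod_J K n) (const_J K n).
       (\<forall>i j. 1 \<le> i \<and> i < j \<and> j \<le> n \<longrightarrow>
          \<psi> (P_G K n i j) =
            class_J K n (e11 (eta_prod (ring_R K n) (ring.indexed_var K) i (j - 1 - i)))) \<longrightarrow>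
       (\<forall>y\<in>carrier (G_ring K n). \<psi> y = inv_into (carrier (R_mod_J K n)) \<phi> y))"
proof -
  interpret frieze_ring K n using assms by (simp add: frieze_ring_def frieze_ring_axioms_def)
  obtain \<phi> where \<phi>: "\<phi> \<in> alg_hom K (R_mod_J K n) (const_J K n) (G_ring K n) (const_G K n)"
    and \<phi>_c: "\<And>i. 1 \<le> i \<Longrightarrow> i \<le> n \<Longrightarrow> \<phi> (c\<^sub>R i) = c\<^sub>G i"
    using exists_phi by blast
  obtain \<psi> where \<psi>: "\<psi> \<in> alg_hom K (G_ring K n) (const_G K n) (R_mod_J K n) (const_J K n)"
    and \<psi>_P: "\<And>i j. 1 \<le> i \<Longrightarrow> i < j \<Longrightarrow> j \<le> n \<Longrightarrow>
      \<psi> (P_G K n i j) = continuant (R_mod_J K n) (\<lambda>i. c\<^sub>R i) i (j - i)"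
    using exists_psi by blast
  have \<phi>_hom: "\<phi> \<in> ring_hom (R_mod_J K n) (G_ring K n)" and \<psi>_hom: "\<psi> \<in> ring_hom (G_ring K n) (R_mod_J K n)"
    using \<phi> \<psi> by (auto simp: alg_hom_def)
  have \<phi>_const: "\<phi> (const_J K n k) = const_G K n k" and \<psi>_const: "\<psi> (const_G K n k) = const_J K n k"
    if "k \<in> carrier K" for k
    using \<phi> \<psi> that by (auto simp: alg_hom_def)
  have \<psi>\<phi>: "\<psi> (\<phi> x) = x" if "x \<in> carrier (R_mod_J K n)" for x
  proof -
    have "(\<psi> \<circ> \<phi>) x = id x"
    proof (rule R_mod_J_hom_eqI[OF Q.ring_axioms _ _ _ _ that])
      show "\<psi> \<circ> \<phi> \<in> ring_hom (R_mod_J K n) (R_mod_J K n)" by (rule ring_hom_trans[OF \<phi>_hom \<psi>_hom])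
      show "id \<in> ring_hom (R_mod_J K n) (R_mod_J K n)" by (auto simp: ring_hom_def)
    qed (simp_all only: \<phi>_const \<psi>_const \<phi>_c psi_c_G[OF \<psi>_P] comp_apply id_apply)
    then show ?thesis by simp
  qed
  have \<phi>\<psi>: "\<phi> (\<psi> y) = y" if "y \<in> carrier (G_ring K n)" for y
  proof -
    have "(\<phi> \<circ> \<psi>) y = id y"
    proof (rule G_hom_eqI[OF G.ring_axioms _ _ _ _ that])
      show "\<phi> \<circ> \<psi> \<in> ring_hom (G_ring K n) (G_ring K n)" by (rule ring_hom_trans[OF \<psi>_hom \<phi>_hom])
      show "id \<in> ring_hom (G_ring K n) (G_ring K n)" by (auto simp: ring_hom_def)
    qed (simp_all add: \<phi>_const \<psi>_const \<psi>_P phi_continuant[OF \<phi>_hom \<phi>_c])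
    then show ?thesis by simp
  qed
  have bij: "bij_betw \<phi> (carrier (R_mod_J K n)) (carrier (G_ring K n))"
    by (rule bij_betw_byWitness[of _ \<psi>])
       (use \<psi>\<phi> \<phi>\<psi> ring_hom_closed[OF \<phi>_hom] ring_hom_closed[OF \<psi>_hom] in auto)
  \<comment> \<open>The theorem speaks of \<open>inv_into\<close>, whose values are controlled only
    on the image; there it can be replaced by \<psi>.\<close>
  have inv: "inv_into (carrier (R_mod_J K n)) \<phi> y = \<psi> y" if "y \<in> carrier (G_ring K n)" for y
    using that bij \<phi>\<psi> ring_hom_closed[OF \<psi>_hom] by (intro inv_into_f_eq) (auto simp: bij_betw_def)
  show ?thesis
  proof (intro exI[of _ \<phi>] conjI ballI allI impI)
    show "\<phi> \<in> alg_iso K (R_mod_J K n) (const_J K n) (G_ring K n) (const_G K n)"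
      using \<phi> \<phi>_hom bij by (simp add: alg_iso_def ring_iso_def)
    show "\<phi> (c\<^sub>R i) = c\<^sub>G i" if "i \<in> {1..n}" for i using \<phi>_c that by simp
    show "\<phi>' x = \<phi> x"
      if "\<phi>' \<in> alg_iso K (R_mod_J K n) (const_J K n) (G_ring K n) (const_G K n)"
        "\<forall>i\<in>{1..n}. \<phi>' (c\<^sub>R i) = c\<^sub>G i" "x \<in> carrier (R_mod_J K n)" for \<phi>' x
      by (rule R_mod_J_hom_eqI[OF G.ring_axioms _ \<phi>_hom _ _ that(3)])
         (use that \<phi>_const \<phi>_c in \<open>auto simp: alg_iso_def alg_hom_def\<close>)
    show "inv_into (carrier (R_mod_J K n)) \<phi> \<in> alg_hom K (G_ring K n) (const_G K n) (R_mod_J K n) (const_J K n)"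
      by (rule alg_hom_cong[OF G.ring_axioms ring_hom_closed[OF const_G_hom] \<psi> inv])
    show "inv_into (carrier (R_mod_J K n)) \<phi> (P_G K n i j) =
        class_J K n (e11 (eta_prod (ring_R K n) K.indexed_var i (j - 1 - i)))"
      if "1 \<le> i \<and> i < j \<and> j \<le> n" for i j
      using that class_J_e11[of i j] by (simp only: inv P_G_mem \<psi>_P)
    \<comment> \<open>The prescribed values on the P_{i,j} already determine an algebra
      homomorphism, which is what makes the formula a definition of the inverse.\<close>
    show "\<psi>' y = inv_into (carrier (R_mod_J K n)) \<phi> y"
      if \<psi>': "\<psi>' \<in> alg_hom K (G_ring K n) (const_G K n) (R_mod_J K n) (const_J K n)"
        "\<forall>i j. 1 \<le> i \<and> i < j \<and> j \<le> n \<longrightarrow> \<psi>' (P_G K n i j) =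
          class_J K n (e11 (eta_prod (ring_R K n) K.indexed_var i (j - 1 - i)))"
        and y: "y \<in> carrier (G_ring K n)" for \<psi>' y
      unfolding inv[OF y]
    proof (rule G_hom_eqI[OF Q.ring_axioms _ \<psi>_hom _ _ y])
      show "\<psi>' (P_G K n i j) = \<psi> (P_G K n i j)" if "1 \<le> i" "i < j" "j \<le> n" for i j
        using that \<psi>'(2) class_J_e11[of i j] by (simp only: \<psi>_P)
    qed (use \<psi>'(1) \<psi>_const in \<open>auto simp: alg_hom_def\<close>)
  qed
qed

end
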